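(* Let $A\in\mathbb{R}^{n\times n}$ be symmetric with eigenvalues $\alpha_1\ge\cdots\ge\alpha_n$, $g\in\mathbb{R}^n$ nonzero, $\Delta>0$, and consider the TRS of minimizing $\frac12x^TAx+x^Tg$ subject to $\|x\|\le\Delta$, in the easy case. With the notation of the context, suppose $\|x_{opt}\|=\|x_k\|=\Delta$, $k\in\{1,\ldots,k_{\max}\}$, and let $y=(y_1^T,y_2^T)^T$ be a unit-length eigenvector of $M$ associated with $\lambda_{opt}$. Then $$\lambda_{opt}-\lambda_k\le2s_k\Big(1+\frac{2\|y_1\|k\sqrt\kappa}{\|y_2\|\|A_{opt}\|}\Big)\Big(\frac{\sqrt\kappa-1}{\sqrt\kappa+1}\Big)^{2k},\qquad s_k=\frac{\|A_{opt}^{-1}x_{opt}\|}{\|g\|e_1^T(T_k+\lambda_{opt}I)^{-3}e_1}.$$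
   Context: Norms are Euclidean (spectral norm for matrices). $x_{opt}$ is a global minimizer of the TRS with multiplier $\lambda_{opt}\ge0$ ($(A+\lambda_{opt}I)x_{opt}=-g$, $\lambda_{opt}(\Delta-\|x_{opt}\|)=0$, $A+\lambda_{opt}I\succeq0$); easy case: $\lambda_{opt}>-\alpha_n$. $A_{opt}=A+\lambda_{opt}I$, $\kappa=(\alpha_1+\lambda_{opt})/(\alpha_n+\lambda_{opt})$. $M=\begin{pmatrix}-A&gg^T/\Delta^2\\ I&-A\end{pmatrix}$. Lanczos on $A$ with start $g$: $Q_k=[q_1,\ldots,q_k]$ orthonormal basis of $\mathrm{span}\{g,\ldots,A^{k-1}g\}$, $q_1=g/\|g\|$, $T_k=Q_k^TAQ_k$ tridiagonal, $AQ_k=Q_kT_k+\beta_kq_{k+1}e_k^T$; $k_{\max}$ the first breakdown step. GLTR: $x_k=Q_kh_k$, $h_k$ minimizes $\frac12h^TT_kh+\|g\|h^Te_1$ over $\|h\|\le\Delta$, multiplier $\lambda_k\ge0$ with $(T_k+\lambda_kI)h_k=-\|g\|e_1$, $\lambda_k(\Delta-\|h_k\|)=0$, $T_k+\lambda_kI\succeq0$. *)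

theory Defs
  imports "Jordan_Normal_Form.Char_Poly"
begin

text \<open>Matrices and vectors are Jordan_Normal_Form matrices/vectors over the reals,
  so that objects of varying size (A is n x n, T_k is k x k, M is 2n x 2n) can coexist.\<close>

definition vnorm :: "real vec \<Rightarrow> real" where
  "vnorm v = sqrt (v \<bullet> v)"

definition opnorm :: "real mat \<Rightarrow> real" where
  "opnorm B = Sup {vnorm (B *\<^sub>v x) | x. x \<in> carrier_vec (dim_col B) \<and> vnorm x \<le> 1}"

definition symmetric_mat :: "nat \<Rightarrow> real mat \<Rightarrow> bool" where
  "symmetric_mat n B \<longleftrightarrow> B \<in> carrier_mat n n \<and> transpose_mat B = B"

definition psd_mat :: "nat \<Rightarrow> real mat \<Rightarrow> bool" where
  "psd_mat n B \<longleftrightarrow> (\<forall>z \<in> carrier_vec n. z \<bullet> (B *\<^sub>v z) \<ge> 0)"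

definition max_eig :: "real mat \<Rightarrow> real" where
  "max_eig B = Max {a. eigenvalue B a}"
definition min_eig :: "real mat \<Rightarrow> real" where
  "min_eig B = Min {a. eigenvalue B a}"

definition mat_inv :: "real mat \<Rightarrow> real mat" where
  "mat_inv B = (SOME C. C \<in> carrier_mat (dim_col B) (dim_row B) \<and> inverts_mat B C \<and> inverts_mat C B)"

definition lspan :: "nat \<Rightarrow> (nat \<Rightarrow> real vec) \<Rightarrow> nat \<Rightarrow> real vec set" where
  "lspan n v j = {vec n (\<lambda>i. \<Sum>l<j. c l * (v l $ i)) | c. True}"

definition krylov :: "nat \<Rightarrow> real mat \<Rightarrow> real vec \<Rightarrow> nat \<Rightarrow> real vec set" where
  "krylov n B g j = lspan n (\<lambda>l. (B ^\<^sub>m l) *\<^sub>v g) j"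

text \<open>k_max: the first breakdown step of Lanczos, i.e. the least k \<ge> 1 with A^k g in the k-th Krylov space.\<close>
definition kmax :: "nat \<Rightarrow> real mat \<Rightarrow> real vec \<Rightarrow> nat" where
  "kmax n B g = (LEAST k. k \<ge> 1 \<and> (B ^\<^sub>m k) *\<^sub>v g \<in> krylov n B g k)"

text \<open>Lanczos vectors q_1,...,q_k (stored as q 0, ..., q (k-1)): orthonormal, q_1 = g/||g||,
  and span{q_1..q_j} = span{g,..,A^(j-1) g} for j = 1..k.\<close>
definition lanczos_vecs :: "nat \<Rightarrow> real mat \<Rightarrow> real vec \<Rightarrow> nat \<Rightarrow> (nat \<Rightarrow> real vec) \<Rightarrow> bool" where
  "lanczos_vecs n B g k q \<longleftrightarrow>
     (\<forall>i<k. q i \<in> carrier_vec n) \<and>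
     (\<forall>i<k. \<forall>j<k. q i \<bullet> q j = (if i = j then 1 else 0)) \<and>
     q 0 = (1 / vnorm g) \<cdot>\<^sub>v g \<and>
     (\<forall>j \<in> {1..k}. lspan n q j = krylov n B g j)"

definition Qmat :: "nat \<Rightarrow> nat \<Rightarrow> (nat \<Rightarrow> real vec) \<Rightarrow> real mat" where
  "Qmat n k q = mat_of_cols n (map q [0..<k])"

definition Tmat :: "nat \<Rightarrow> nat \<Rightarrow> (nat \<Rightarrow> real vec) \<Rightarrow> real mat \<Rightarrow> real mat" where
  "Tmat n k q B = transpose_mat (Qmat n k q) * B * Qmat n k q"

definition trs_obj :: "real mat \<Rightarrow> real vec \<Rightarrow> real vec \<Rightarrow> real" where
  "trs_obj B c x = 1/2 * (x \<bullet> (B *\<^sub>v x)) + x \<bullet> c"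

definition trs_global_min :: "nat \<Rightarrow> real mat \<Rightarrow> real vec \<Rightarrow> real \<Rightarrow> real vec \<Rightarrow> bool" where
  "trs_global_min n B c \<Delta> x \<longleftrightarrow> x \<in> carrier_vec n \<and> vnorm x \<le> \<Delta> \<and>
     (\<forall>z \<in> carrier_vec n. vnorm z \<le> \<Delta> \<longrightarrow> trs_obj B c x \<le> trs_obj B c z)"

definition trs_multiplier :: "nat \<Rightarrow> real mat \<Rightarrow> real vec \<Rightarrow> real \<Rightarrow> real vec \<Rightarrow> real \<Rightarrow> bool" where
  "trs_multiplier n B c \<Delta> x l \<longleftrightarrow> l \<ge> 0 \<and>
     (B + l \<cdot>\<^sub>m 1\<^sub>m n) *\<^sub>v x = - c \<and> l * (\<Delta> - vnorm x) = 0 \<and> psd_mat n (B + l \<cdot>\<^sub>m 1\<^sub>m n)"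

definition Mmat :: "nat \<Rightarrow> real mat \<Rightarrow> real vec \<Rightarrow> real \<Rightarrow> real mat" where
  "Mmat n B g \<Delta> = four_block_mat (- B) ((1 / \<Delta>^2) \<cdot>\<^sub>m mat n n (\<lambda>(i,j). g $ i * g $ j))
                                 (1\<^sub>m n) (- B)"

end

theory Submission
  imports Defs
begin

text \<open>
  Put \<open>B = A + \<lambda>\<^sub>o\<^sub>p\<^sub>t I\<close>, \<open>T = T\<^sub>k + \<lambda>\<^sub>o\<^sub>p\<^sub>t I\<close> and \<open>c = \<parallel>g\<parallel> e\<^sub>1\<close>. The function
  \<open>\<mu> \<mapsto> \<parallel>(T + \<mu> I)\<^sup>-\<^sup>1 c\<parallel>\<^sup>2\<close> is convex and takes the value \<open>\<Delta>\<^sup>2\<close> at \<open>\<lambda>\<^sub>k - \<lambda>\<^sub>o\<^sub>p\<^sub>t\<close>, so its tangent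
  at 0 bounds \<open>\<lambda>\<^sub>o\<^sub>p\<^sub>t - \<lambda>\<^sub>k\<close> by \<open>(g \<bullet> B\<^sup>-\<^sup>2 g - c \<bullet> T\<^sup>-\<^sup>2 c) / (2 c \<bullet> T\<^sup>-\<^sup>3 c)\<close>. The numerator is the
  error of the k-point Gauss quadrature for \<open>1/t\<^sup>2\<close>, which is exact in degrees at most \<open>2k - 1\<close>.
  If p is the scaled Chebyshev polynomial of degree 2k for the spectral interval with \<open>p(0) = 1\<close>
  and \<open>d = - p'(0)\<close>, then \<open>(1 - (1 + d t) p(t)) / t\<^sup>2\<close> is a polynomial of degree at most
  \<open>2k - 1\<close>, so only \<open>(1 + d t) p(t) / t\<^sup>2\<close> contributes to the error. Since \<open>\<bar>p\<bar> \<le> 2 \<rho>\<^sup>2\<^sup>k\<close> on the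
  interval, with \<open>\<rho> = (\<surd>\<kappa> - 1) / (\<surd>\<kappa> + 1)\<close>, and \<open>d \<le> 2k \<surd>\<kappa> / \<parallel>B\<parallel>\<close>, the bound follows.
\<close>

section \<open>Chebyshev polynomials\<close>

text \<open>\<open>chebU x n\<close> is the Chebyshev polynomial of the second kind of index \<open>n - 1\<close>.\<close>
fun chebT :: "'a::comm_ring_1 \<Rightarrow> nat \<Rightarrow> 'a" and chebU :: "'a \<Rightarrow> nat \<Rightarrow> 'a" where
  "chebT x 0 = 1"
| "chebT x (Suc n) = x * chebT x n + (x * x - 1) * chebU x n"
| "chebU x 0 = 0"
| "chebU x (Suc n) = chebT x n + x * chebU x n"

text \<open>Each recursion step multiplies T + U sqrt(x^2 - 1) by x + sqrt(x^2 - 1), which has norm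
  1, so the norm stays 1. The identity later rewrites 1 - T^2 as (1 - x^2) U^2, whose sign on the
  interval is visible.\<close>

lemma chebT_chebU_pell:
  "chebT x n * chebT x n - (x * x - 1) * (chebU x n * chebU x n) = 1"
proof (induction n)
  case (Suc n)
  have "chebT x (Suc n) * chebT x (Suc n) - (x * x - 1) * (chebU x (Suc n) * chebU x (Suc n))
      = chebT x n * chebT x n - (x * x - 1) * (chebU x n * chebU x n)"
    by (simp add: algebra_simps)
  then show ?case using Suc by simp
qed simp

lemma poly_chebT_chebU:
  "poly (chebT p n) x = chebT (poly p x) n" "poly (chebU p n) x = chebU (poly p x) n"
  by (induction n) auto

text \<open>The two identities need each other in the induction. The second carries the factor
  \<open>p * p - 1\<close> because the derivative of U is a quotient by it.\<close>

lemma pderiv_chebT_chebU: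
  fixes p :: "real poly"
  shows "pderiv (chebT p n) = of_nat n * chebU p n * pderiv p"
    and "(p * p - 1) * pderiv (chebU p n) = (of_nat n * chebT p n - p * chebU p n) * pderiv p"
proof (induction n)
  case (Suc n)
  show "pderiv (chebT p (Suc n)) = of_nat (Suc n) * chebU p (Suc n) * pderiv p"
  proof -
    have "pderiv (chebT p (Suc n)) = p * pderiv (chebT p n) + pderiv p * chebT p n
        + (p * p - 1) * pderiv (chebU p n) + 2 * p * pderiv p * chebU p n"
      by (simp add: pderiv_add pderiv_mult pderiv_diff algebra_simps)
    then show ?thesis by (simp only: Suc) (simp add: algebra_simps)
  qed
  have "(p * p - 1) * pderiv (chebU p (Suc n))
      = (p * p - 1) * pderiv (chebT p n) + (p * p - 1) * pderiv p * chebU p n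
        + p * ((p * p - 1) * pderiv (chebU p n))"
    by (simp add: pderiv_add pderiv_mult pderiv_diff algebra_simps)
  then show "(p * p - 1) * pderiv (chebU p (Suc n))
      = (of_nat (Suc n) * chebT p (Suc n) - p * chebU p (Suc n)) * pderiv p"
    by (simp only: Suc) (simp add: algebra_simps)
qed auto

lemma degree_chebT_chebU:
  fixes p :: "real poly"
  assumes "degree p \<le> 1"
  shows "degree (chebT p n) \<le> n" "degree (chebU p n) \<le> n - 1"
proof (induction n)
  case (Suc n)
  have 1: "degree (p * chebT p n) \<le> Suc n"
    using degree_mult_le[of p "chebT p n"] assms Suc by linarith
  have "degree (p * p - 1) \<le> 2"
    using degree_mult_le[of p p] assms by (intro degree_diff_le) auto
  \<comment> \<open>For \<open>n = 0\<close> the truncated \<open>n - 1\<close> would only give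
    degree 2, but \<open>chebU p 0\<close> is 0.\<close>
  then have 2: "degree ((p * p - 1) * chebU p n) \<le> Suc n"
    using degree_mult_le[of "p * p - 1" "chebU p n"] Suc by (cases n) auto
  have 3: "degree (p * chebU p n) \<le> n"
    using degree_mult_le[of p "chebU p n"] assms Suc by (cases n) auto
  show "degree (chebT p (Suc n)) \<le> Suc n" "degree (chebU p (Suc n)) \<le> Suc n - 1"
    using 1 2 3 Suc by (auto intro: degree_add_le)
qed auto

text \<open>r and 1/r are the roots of z^2 - 2xz + 1, and the recursion multiplies their powers. The
  factor \<open>r - 1 / r\<close> is kept on the left to avoid a division.\<close>

lemma chebT_chebU_closed_form:
  fixes r :: real
  assumes "r \<noteq> 0"
  shows "chebT ((r + 1 / r) / 2) n = (r ^ n + 1 / r ^ n) / 2"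
    and "(r - 1 / r) * chebU ((r + 1 / r) / 2) n = r ^ n - 1 / r ^ n"
proof (induction n)
  case (Suc n)
  let ?x = "(r + 1 / r) / 2"
  have sq: "?x * ?x - 1 = ((r - 1 / r) / 4) * (r - 1 / r)"
    using assms by (simp add: field_simps)
  have "chebT ?x (Suc n) = ?x * chebT ?x n + (r - 1 / r) / 4 * ((r - 1 / r) * chebU ?x n)"
    by (simp only: chebT.simps sq mult.assoc)
  also have "\<dots> = (r ^ Suc n + 1 / r ^ Suc n) / 2"
    using assms by (simp only: Suc) (simp add: field_simps)
  finally show "chebT ?x (Suc n) = (r ^ Suc n + 1 / r ^ Suc n) / 2" .
  have "(r - 1 / r) * chebU ?x (Suc n) = (r - 1 / r) * chebT ?x n + ?x * ((r - 1 / r) * chebU ?x n)"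
    by (simp only: chebU.simps distrib_left mult.left_commute)
  also have "\<dots> = r ^ Suc n - 1 / r ^ Suc n"
    using assms by (simp only: Suc) (simp add: field_simps)
  finally show "(r - 1 / r) * chebU ?x (Suc n) = r ^ Suc n - 1 / r ^ Suc n" .
qed auto

section \<open>Moment functionals and the quadrature error\<close>

text \<open>The Riesz functional of the sequence m: linear, with X^i sent to
  \<open>m i\<close>.\<close>

definition moment_fun :: "(nat \<Rightarrow> real) \<Rightarrow> real poly \<Rightarrow> real" where
  "moment_fun m p = (\<Sum>i\<le>degree p. coeff p i * m i)"

lemma moment_fun_upto:
  assumes "degree p \<le> d"
  shows "moment_fun m p = (\<Sum>i\<le>d. coeff p i * m i)"
  unfolding moment_fun_def using assms
  by (intro sum.mono_neutral_left) (auto simp: coeff_eq_0)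

lemma moment_fun_add: "moment_fun m (p + q) = moment_fun m p + moment_fun m q"
proof -
  let ?d = "max (degree p) (degree q)"
  have "degree (p + q) \<le> ?d" by (rule degree_add_le_max)
  then show ?thesis
    by (simp add: moment_fun_upto[of _ ?d] algebra_simps sum.distrib)
qed

lemma moment_fun_smult: "moment_fun m (Polynomial.smult c p) = c * moment_fun m p"
  by (simp add: moment_fun_upto[of _ "degree p"] sum_distrib_left mult.assoc)

lemma moment_fun_diff: "moment_fun m (p - q) = moment_fun m p - moment_fun m q"
  using moment_fun_add[of m p "Polynomial.smult (-1) q"] moment_fun_smult[of m "-1" q] by simp

lemma poly_ext: "(\<And>x. poly p x = poly q x) \<Longrightarrow> p = (q :: real poly)"
  by (simp add: poly_eq_poly_eq_iff[symmetric] fun_eq_iff)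

lemma moment_fun_0 [simp]: "moment_fun m 0 = 0"
  by (simp add: moment_fun_def)

lemma moment_fun_sum: "moment_fun m (sum f S) = (\<Sum>i\<in>S. moment_fun m (f i))"
  by (induction S rule: infinite_finite_induct) (auto simp: moment_fun_add)

lemma moment_fun_monom: "moment_fun m (monom c i) = c * m i"
proof -
  have "(\<Sum>j\<le>i. coeff (monom c i) j * m j) = (\<Sum>j\<in>{i}. c * m j)"
    by (rule sum.mono_neutral_cong_right) auto
  then show ?thesis by (simp add: moment_fun_upto[OF degree_monom_le])
qed

lemma moment_fun_mult:
  "moment_fun m (p * q)
    = (\<Sum>i\<le>degree p. \<Sum>j\<le>degree q. coeff p i * coeff q j * m (i + j))"
proof -
  have "p * q = (\<Sum>i\<le>degree p. \<Sum>j\<le>degree q. monom (coeff p i * coeff q j) (i + j))"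
    using arg_cong2[of _ _ _ _ "(*)", OF poly_as_sum_of_monoms[of p] poly_as_sum_of_monoms[of q]]
    by (simp add: sum_product mult_monom)
  then show ?thesis by (simp add: moment_fun_sum moment_fun_monom)
qed

text \<open>
  Positivity on the quadratic module of \<open>[a, b]\<close>: it stands in for integration against a measure
  supported there and holds for \<open>w \<bullet> C\<^sup>i w\<close> without diagonalising C.
\<close>
definition moments_on :: "real \<Rightarrow> real \<Rightarrow> (nat \<Rightarrow> real) \<Rightarrow> bool" where
  "moments_on a b m \<longleftrightarrow> (\<forall>q. moment_fun m (q * q) \<ge> 0 \<and> moment_fun m (q * q * [:-a, 1:]) \<ge> 0
      \<and> moment_fun m (q * q * [:b, -1:]) \<ge> 0)"

lemma moments_on_X_sq:
  assumes "moments_on a b m" "0 < a"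
  shows "moment_fun m (q * q * [:0, 1:]) \<ge> 0"
proof -
  have "q * q * [:0, 1:] = Polynomial.smult a (q * q) + q * q * [:-a, 1:]"
    by (simp add: algebra_simps)
  then show ?thesis using assms
    by (simp only: moment_fun_add moment_fun_smult) (simp add: moments_on_def)
qed

text \<open>The product of both end-point factors is not among the generators. Multiplying it by b -
  a = (X - a) + (b - X) gives squares times one generator each. A further factor X splits as a + (X
  - a).\<close>

lemma moments_on_interval:
  assumes m: "moments_on a b m" and ab: "0 < a" "a < b"
  shows "moment_fun m (q * q * ([:-a, 1:] * [:b, -1:])) \<ge> 0"
    and "moment_fun m (q * q * ([:-a, 1:] * [:b, -1:]) * [:0, 1:]) \<ge> 0"
proof -
  have pos: "moment_fun m (q * q * [:-a, 1:]) \<ge> 0" "moment_fun m (q * q * [:b, -1:]) \<ge> 0" for q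
    using m by (auto simp: moments_on_def)
  show *: "moment_fun m (q * q * ([:-a, 1:] * [:b, -1:])) \<ge> 0" for q
  proof -
    have "Polynomial.smult (b - a) (q * q * ([:-a, 1:] * [:b, -1:]))
       = (q * [:-a, 1:]) * (q * [:-a, 1:]) * [:b, -1:] + (q * [:b, -1:]) * (q * [:b, -1:]) * [:-a, 1:]"
      by (rule poly_ext) (simp add: algebra_simps)
    then have "(b - a) * moment_fun m (q * q * ([:-a, 1:] * [:b, -1:])) \<ge> 0"
      using pos[of "q * [:-a, 1:]"] pos[of "q * [:b, -1:]"]
      by (simp only: moment_fun_smult[symmetric] moment_fun_add)
    then show ?thesis using ab by (simp add: zero_le_mult_iff)
  qed
  have "q * q * ([:-a, 1:] * [:b, -1:]) * [:0, 1:]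
     = Polynomial.smult a (q * q * ([:-a, 1:] * [:b, -1:])) + (q * [:-a, 1:]) * (q * [:-a, 1:]) * [:b, -1:]"
    by (rule poly_ext) (simp add: algebra_simps)
  then show "moment_fun m (q * q * ([:-a, 1:] * [:b, -1:]) * [:0, 1:]) \<ge> 0"
    using ab *[of q] pos(2)[of "q * [:-a, 1:]"] by (simp only: moment_fun_smult moment_fun_add) simp
qed


text \<open>
  With \<open>w = B\<^sup>-\<^sup>2 g\<close>, the moment of index \<open>i + 4\<close> is \<open>g \<bullet> B\<^sup>i g\<close>; hence \<open>m 2\<close> is the integral of
  \<open>1/t\<^sup>2\<close> and quadrature exactness starts at index 4.
\<close>
lemma quadrature_error:
  assumes m: "moments_on a b m" "moments_on a b m'" and ab: "0 < a" "a < b"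
    and eq: "\<And>i. 4 \<le> i \<Longrightarrow> i \<le> 2 * k + 3 \<Longrightarrow> m i = m' i"
    and m3: "m' 3 \<le> m 3"
  shows "m 2 - m' 2 \<le> 4 * ((sqrt (b / a) - 1) / (sqrt (b / a) + 1)) ^ (2 * k)
           * (m 2 + 2 * real k * sqrt (b / a) / b * m 3)"
proof -
  define s where "s = sqrt (b / a)"
  have s: "s > 1" "s * s = b / a" using ab by (auto simp: s_def)
  then have b: "b = a * (s * s)" using ab by simp
  have ss: "s * s > 1" using s ab by simp
  \<comment> \<open>The reciprocal of the convergence factor. It satisfies (r + 1/r)/2 = c, where c
    is the image of 0 under the map \<open>l\<close> below, so the Chebyshev values there have
    closed forms in r.\<close>
  define r where "r = (s + 1) / (s - 1)"
  have r: "r > 1" using s by (simp add: r_def)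
  have r_diff: "r - 1 / r = 4 * s / (s * s - 1)"
    using s ss by (simp add: r_def divide_simps) (simp add: algebra_simps)
  define c where "c = (b + a) / (b - a)"
  have c: "c = (r + 1 / r) / 2"
  proof -
    have "c = (s * s + 1) / (s * s - 1)"
      using ab ss by (simp add: c_def b divide_simps) (simp add: algebra_simps)
    also have "\<dots> = (r + 1 / r) / 2"
      using s ss by (simp add: r_def divide_simps) (simp add: algebra_simps)
    finally show ?thesis .
  qed
  \<comment> \<open>The affine map sending a to 1, b to -1 and 0 to c > 1.\<close>
  define l where "l = [:c, - 2 / (b - a):]"
  define t where "t = chebT c k"
  define u where "u = chebU c k"
  \<comment> \<open>By the doubling formula P is the Chebyshev polynomial of degree 2k in
    \<open>l\<close>; in this form 1 + P is twice a square. N and D below are P(0) and -P'(0), so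
    the scaled polynomial of the overview is P/N and its d is D/N.\<close>
  define P where "P = Polynomial.smult 2 (chebT l k * chebT l k) - 1"
  define N where "N = 2 * t * t - 1"
  define D where "D = 8 * real k * t * u / (b - a)"
  have t: "t = (r ^ k + 1 / r ^ k) / 2" and u: "(r - 1 / r) * u = r ^ k - 1 / r ^ k"
    using chebT_chebU_closed_form[of r k] r by (auto simp: t_def u_def c)
  have rk: "r ^ k \<ge> 1" "r ^ k > 0" using r by (auto simp: one_le_power)
  have N: "N = (r ^ k * r ^ k + 1 / (r ^ k * r ^ k)) / 2"
    unfolding N_def t using rk r by (simp add: field_simps)
  have N_ge: "N \<ge> r ^ (2 * k) / 2" using rk by (simp add: N mult_2 power_add)
  have "r ^ (2 * k) > 0" using r by simp
  then have N_pos: "N > 0" using N_ge by linarith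
  have tu: "(r - 1 / r) * (2 * t * u) = r ^ k * r ^ k - 1 / (r ^ k * r ^ k)"
  proof -
    have "(r - 1 / r) * (2 * t * u) = 2 * t * ((r - 1 / r) * u)" by simp
    then show ?thesis unfolding u t using rk r by (simp add: field_simps)
  qed
  have r_diff_pos: "r - 1 / r > 0" using s ss by (simp add: r_diff)
  have "(r - 1 / r) * (2 * t * u) \<ge> 0"
  proof -
    have "r ^ k * r ^ k \<ge> 1" using rk mult_mono[of 1 "r ^ k" 1 "r ^ k"] by simp
    moreover from this have "1 / (r ^ k * r ^ k) \<le> 1" by simp
    ultimately show ?thesis unfolding tu by linarith
  qed
  then have tu_nonneg: "t * u \<ge> 0"
    using r_diff_pos by (simp add: zero_le_mult_iff mult.assoc)
  have D_nonneg: "D \<ge> 0" using tu_nonneg ab by (simp add: D_def mult.assoc)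
  \<comment> \<open>Times r - 1/r, the product 2tu is r^(2k) - r^(-2k), hence at most 2N. The
    constant then comes from r - 1/r = 4s/(s^2 - 1) and b - a = a(s^2 - 1).\<close>
  have DN: "D \<le> 2 * real k * s / b * N"
  proof -
    have "(r - 1 / r) * (2 * t * u) \<le> 2 * N" unfolding tu N using rk by simp
    then have "2 * t * u \<le> 2 * N / (r - 1 / r)" using r_diff_pos by (simp add: field_simps)
    also have "\<dots> = N * (s * s - 1) / (2 * s)" using ss s by (simp add: r_diff)
    finally have "4 * real k / (b - a) * (2 * t * u) \<le> 4 * real k / (b - a) * (N * (s * s - 1) / (2 * s))"
      using ab by (intro mult_left_mono) auto
    also have "\<dots> = 2 * real k * s / b * N"
    proof -
      have ba: "b - a = a * (s * s - 1)" by (simp add: b algebra_simps)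
      have nz: "a \<noteq> 0" "s \<noteq> 0" "s * s - 1 \<noteq> 0" using ab s(1) ss by auto
      have "4 * K / (a * X) * (N * X / (2 * s)) = 2 * K * s / (a * (s * s)) * N" if "X \<noteq> 0" for X K
        using that nz by (simp add: field_simps)
      from this[OF nz(3), of "real k"] show ?thesis unfolding ba b[symmetric] .
    qed
    finally show ?thesis by (simp add: D_def)
  qed
  have l0: "poly l 0 = c" by (simp add: l_def)
  have P0: "coeff P 0 = N"
    by (simp add: P_def poly_0_coeff_0[symmetric] poly_chebT_chebU l0 N_def t_def)
  have "coeff P 1 = poly (pderiv P) 0"
    by (simp add: poly_0_coeff_0 coeff_pderiv)
  also have "\<dots> = - D"
    by (simp add: P_def pderiv_diff pderiv_smult pderiv_mult pderiv_chebT_chebU poly_chebT_chebU l0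
        D_def t_def u_def) (simp add: l_def pderiv_pCons field_simps)
  finally have P1: "coeff P 1 = - D" .
  \<comment> \<open>The weight N + D X cancels the X^3 coefficient, since N P'(0) + D P(0) = 0. As
    the moments agree from index 4 up to the degree 2k + 3, only the X^2 coefficient contributes to
    the difference.\<close>
  define f where "f = [:0, 0, N, D:] * P"
  have f: "coeff f 0 = 0" "coeff f 1 = 0" "coeff f 2 = N * N" "coeff f 3 = 0"
    using P0 P1 by (simp_all add: f_def numeral_eq_Suc coeff_pCons_Suc)
  have "degree l \<le> 1" by (simp add: l_def)
  then have "degree (chebT l k * chebT l k) \<le> 2 * k"
    using degree_mult_le[of "chebT l k" "chebT l k"] degree_chebT_chebU(1)[of l k] by linarith
  then have "degree P \<le> 2 * k"
    unfolding P_def by (intro degree_diff_le) (auto intro: order.trans[OF degree_smult_le])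
  moreover have "degree [:0, 0, N, D:] \<le> 3" by simp
  ultimately have f_deg: "degree f \<le> 2 * k + 3"
    unfolding f_def using degree_mult_le[of "[:0, 0, N, D:]" P] by linarith
  have "moment_fun m f - moment_fun m' f = (\<Sum>i\<le>2 * k + 3. coeff f i * (m i - m' i))"
    by (simp add: moment_fun_upto[OF f_deg] sum_subtractf right_diff_distrib)
  also have "\<dots> = (\<Sum>i\<in>{2}. coeff f i * (m i - m' i))"
  proof (rule sum.mono_neutral_right)
    show "\<forall>i\<in>{..2 * k + 3} - {2}. coeff f i * (m i - m' i) = 0"
    proof
      fix i assume i: "i \<in> {..2 * k + 3} - {2}"
      consider "i = 0" | "i = 1" | "i = 3" | "4 \<le> i" using i by force
      then show "coeff f i * (m i - m' i) = 0" using f eq i by cases auto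
    qed
  qed auto
  finally have diff: "moment_fun m f - moment_fun m' f = N * N * (m 2 - m' 2)" using f by simp
  have weight: "moment_fun \<mu> [:0, 0, N, D:] = N * \<mu> 2 + D * \<mu> 3" for \<mu>
    by (subst moment_fun_upto[of _ 3]) (simp_all add: numeral_eq_Suc)
  \<comment> \<open>Algebraic form of P \<le> 1 on [a, b]: by the Pell identity, X^2 (N + D X)(1 -
    P) is a nonnegative combination of squares times (X - a)(b - X), with or without a factor
    X.\<close>
  have upper: "moment_fun \<mu> f \<le> N * \<mu> 2 + D * \<mu> 3" if \<mu>: "moments_on a b \<mu>" for \<mu>
  proof -
    define q where "q = [:0, 1:] * chebU l k"
    have one_minus_P: "1 - poly P x = 8 / (b - a) ^ 2 * ((x - a) * (b - x)) * (poly (chebU l k) x) ^ 2"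
      for x
    proof -
      have "1 - poly P x = 2 * (1 - poly l x * poly l x) * (poly (chebU l k) x) ^ 2"
        using chebT_chebU_pell[of "poly l x" k]
        by (simp add: P_def poly_chebT_chebU power2_eq_square algebra_simps)
      moreover have "1 - poly l x * poly l x = 4 / (b - a) ^ 2 * ((x - a) * (b - x))"
      proof -
        have lx: "poly l x = (b + a - 2 * x) / (b - a)"
          by (simp add: l_def c_def diff_divide_distrib add_divide_distrib)
        have frac: "1 - y / d * (y / d) = 4 / d ^ 2 * z" if "d \<noteq> 0" "d * d - y * y = 4 * z" for y d z :: real
        proof -
          have "1 - y / d * (y / d) = (d * d - y * y) / (d * d)" using that(1) by (simp add: field_simps)
          then show ?thesis by (simp add: that(2) power2_eq_square)
        qed
        show ?thesis unfolding lx using ab by (intro frac) (auto simp: algebra_simps)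
      qed
      ultimately show ?thesis by simp
    qed
    have "[:0, 0, N, D:] - f = Polynomial.smult (8 / (b - a) ^ 2)
       (Polynomial.smult N (q * q * ([:-a, 1:] * [:b, -1:]))
        + Polynomial.smult D (q * q * ([:-a, 1:] * [:b, -1:]) * [:0, 1:]))" (is "_ = ?R")
    proof (rule poly_ext)
      fix x
      have "poly ([:0, 0, N, D:] - f) x = (N + D * x) * (x * x) * (1 - poly P x)"
        by (simp add: f_def algebra_simps)
      also have "\<dots> = poly ?R x"
        unfolding one_minus_P by (simp add: q_def power2_eq_square) (simp add: algebra_simps)
      finally show "poly ([:0, 0, N, D:] - f) x = poly ?R x" .
    qed
    then have "moment_fun \<mu> [:0, 0, N, D:] - moment_fun \<mu> f = 8 / (b - a) ^ 2 *
       (N * moment_fun \<mu> (q * q * ([:-a, 1:] * [:b, -1:]))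
        + D * moment_fun \<mu> (q * q * ([:-a, 1:] * [:b, -1:]) * [:0, 1:]))"
      by (simp only: moment_fun_diff[symmetric] moment_fun_add[symmetric] moment_fun_smult[symmetric])
    moreover have "\<dots> \<ge> 0"
      using moments_on_interval[OF \<mu> ab, of q] N_pos D_nonneg
      by (intro mult_nonneg_nonneg add_nonneg_nonneg) auto
    ultimately show ?thesis by (simp add: weight)
  qed
  \<comment> \<open>Algebraic form of P \<ge> -1: since 1 + P is twice a square, squares and squares
    times X suffice.\<close>
  have lower: "moment_fun \<mu> f \<ge> - (N * \<mu> 2 + D * \<mu> 3)" if \<mu>: "moments_on a b \<mu>" for \<mu>
  proof -
    define q where "q = [:0, 1:] * chebT l k"
    have "[:0, 0, N, D:] + f = Polynomial.smult 2
       (Polynomial.smult N (q * q) + Polynomial.smult D (q * q * [:0, 1:]))"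
      by (rule poly_ext) (simp add: f_def P_def q_def algebra_simps)
    then have "moment_fun \<mu> [:0, 0, N, D:] + moment_fun \<mu> f
       = 2 * (N * moment_fun \<mu> (q * q) + D * moment_fun \<mu> (q * q * [:0, 1:]))"
      by (simp only: moment_fun_add[symmetric] moment_fun_smult[symmetric])
    moreover have "\<dots> \<ge> 0"
      using moments_on_X_sq[OF \<mu> ab(1), of q] \<mu> N_pos D_nonneg
      by (intro mult_nonneg_nonneg add_nonneg_nonneg) (auto simp: moments_on_def)
    ultimately show ?thesis by (simp add: weight)
  qed
  have nonneg: "m 2 \<ge> 0" "m 3 \<ge> 0"
  proof -
    have "moment_fun m ([:0, 1:] * [:0, 1:]) \<ge> 0" using m unfolding moments_on_def by blast
    moreover have "moment_fun m ([:0, 1:] * [:0, 1:] * [:0, 1:]) \<ge> 0"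
      using moments_on_X_sq m ab by blast
    ultimately show "m 2 \<ge> 0" "m 3 \<ge> 0"
      by (simp_all add: moment_fun_def numeral_eq_Suc)
  qed
  \<comment> \<open>A nonpositive difference is trivial. Otherwise \<open>m' 2\<close> is below
    \<open>m 2\<close>, and together with \<open>m3\<close> the primed terms are absorbed at the
    cost of a factor 2.\<close>
  have rhs: "N * (m 2 - m' 2) \<le> 2 * (m 2 + 2 * real k * s / b * m 3)"
  proof (cases "m 2 - m' 2 \<le> 0")
    case True
    then have "N * (m 2 - m' 2) \<le> 0" using N_pos by (simp add: mult_le_0_iff)
    also have "0 \<le> 2 * (m 2 + 2 * real k * s / b * m 3)" using nonneg s ab by simp
    finally show ?thesis .
  next
    case False
    have "N * N * (m 2 - m' 2) \<le> (N * m 2 + D * m 3) + (N * m' 2 + D * m' 3)"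
      using upper[OF m(1)] lower[OF m(2)] diff by linarith
    also have "\<dots> \<le> 2 * (N * m 2 + D * m 3)"
    proof -
      have "N * m' 2 \<le> N * m 2" "D * m' 3 \<le> D * m 3"
        using False N_pos D_nonneg m3 by (simp_all add: mult_left_mono)
      then show ?thesis unfolding mult_2[of "N * m 2 + D * m 3"] by (intro add_left_mono add_mono)
    qed
    also have "\<dots> \<le> 2 * (N * m 2 + 2 * real k * s / b * N * m 3)"
      using DN nonneg by (intro mult_left_mono add_left_mono mult_right_mono) auto
    also have "\<dots> = N * (2 * (m 2 + 2 * real k * s / b * m 3))" by (simp add: algebra_simps)
    finally have "N * (N * (m 2 - m' 2)) \<le> N * (2 * (m 2 + 2 * real k * s / b * m 3))"
      by (simp only: mult.assoc)
    then show ?thesis using N_pos by simp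
  qed
  have "1 / N \<le> 2 * (1 / r) ^ (2 * k)"
  proof -
    have "1 / N \<le> 1 / (r ^ (2 * k) / 2)" using N_ge N_pos r by (intro divide_left_mono) auto
    then show ?thesis by (simp add: power_one_over)
  qed
  then have "1 / N * (2 * (m 2 + 2 * real k * s / b * m 3))
      \<le> 2 * (1 / r) ^ (2 * k) * (2 * (m 2 + 2 * real k * s / b * m 3))"
    using nonneg s ab by (intro mult_right_mono) auto
  moreover have "m 2 - m' 2 \<le> 1 / N * (2 * (m 2 + 2 * real k * s / b * m 3))"
    using rhs N_pos by (simp add: field_simps)
  moreover have "1 / r = (s - 1) / (s + 1)" using s by (simp add: r_def)
  ultimately have "m 2 - m' 2
      \<le> 2 * ((s - 1) / (s + 1)) ^ (2 * k) * (2 * (m 2 + 2 * real k * s / b * m 3))" by simp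
  also have "\<dots> = 4 * ((s - 1) / (s + 1)) ^ (2 * k) * (m 2 + 2 * real k * s / b * m 3)"
    by (simp only: mult.assoc mult.left_commute)
  finally show ?thesis by (simp only: s_def)
qed

text \<open>For a = b the interval map degenerates. The functional then vanishes on squares times X
  - a, as if supported at the point a, so index 4 determines index 2.\<close>

lemma quadrature_error_degenerate:
  assumes m: "moments_on a a m" "moments_on a a m'" and a: "0 < a" and eq: "m 4 = m' 4"
  shows "m 2 = m' 2"
proof -
  have *: "\<mu> 4 = a * a * \<mu> 2" if \<mu>: "moments_on a a \<mu>" for \<mu>
  proof -
    have z: "moment_fun \<mu> (q * q * [:-a, 1:]) = 0" for q
    proof -
      have "q * q * [:a, -1:] = Polynomial.smult (-1) (q * q * [:-a, 1:])"
        by simp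
      then have "moment_fun \<mu> (q * q * [:a, -1:]) = - moment_fun \<mu> (q * q * [:-a, 1:])"
        by (simp only: moment_fun_smult)
      then show ?thesis using \<mu> unfolding moments_on_def by (metis neg_0_le_iff_le order_antisym)
    qed
    \<comment> \<open>X^4 - a^2 X^2 = (X^3 + a X^2)(X - a), where X^3 is a quarter of (X + X^2)^2 -
      (X - X^2)^2.\<close>
    have "[:0, 0, - a * a, 0, 1:]
        = Polynomial.smult (1 / 4) ([:0, 1, 1:] * [:0, 1, 1:] * [:-a, 1:])
          + Polynomial.smult (- 1 / 4) ([:0, 1, -1:] * [:0, 1, -1:] * [:-a, 1:])
          + Polynomial.smult a ([:0, 1:] * [:0, 1:] * [:-a, 1:])"
      by (rule poly_ext) (simp add: field_simps)
    then have "moment_fun \<mu> [:0, 0, - a * a, 0, 1:] = 0"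
      by (simp only: moment_fun_add moment_fun_smult z)
    then show ?thesis by (simp add: moment_fun_def numeral_eq_Suc)
  qed
  show ?thesis using *[OF m(1)] *[OF m(2)] eq a by simp
qed

section \<open>Quadratic forms of symmetric matrices\<close>

lemma symmetric_mat_carrier: "symmetric_mat n C \<Longrightarrow> C \<in> carrier_mat n n"
  by (simp add: symmetric_mat_def)

lemma symmetric_mat_scalar_prod:
  assumes "symmetric_mat n C" "u \<in> carrier_vec n" "v \<in> carrier_vec n"
  shows "u \<bullet> (C *\<^sub>v v) = (C *\<^sub>v u) \<bullet> v"
  using transpose_vec_mult_scalar[of C n n v u] assms by (simp add: symmetric_mat_def)

lemma shift_mult_vec:
  fixes C :: "real mat"
  assumes "C \<in> carrier_mat n n" "v \<in> carrier_vec n"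
  shows "(C + l \<cdot>\<^sub>m 1\<^sub>m n) *\<^sub>v v = C *\<^sub>v v + l \<cdot>\<^sub>v v"
  using assms by (intro eq_vecI)
    (auto simp: add_scalar_prod_distrib[of _ n] scalar_prod_left_unit)

lemma symmetric_mat_shift:
  "symmetric_mat n C \<Longrightarrow> symmetric_mat n (C + l \<cdot>\<^sub>m 1\<^sub>m n)"
  unfolding symmetric_mat_def
  by (auto intro!: eq_matI) (metis index_transpose_mat(1) carrier_matD)

lemma symmetric_mat_one: "symmetric_mat n (1\<^sub>m n)"
  by (simp add: symmetric_mat_def)

lemma scalar_prod_self_nonneg: "(v :: real vec) \<bullet> v \<ge> 0"
  by (simp add: scalar_prod_def sum_nonneg)

lemma scalar_prod_self_eq_0:
  assumes "(v :: real vec) \<in> carrier_vec n" "v \<bullet> v = 0"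
  shows "v = 0\<^sub>v n"
  using assms by (intro eq_vecI) (auto simp: scalar_prod_def sum_nonneg_eq_0_iff)

lemma quadratic_form_add_smult:
  assumes C: "symmetric_mat n C" and uv: "u \<in> carrier_vec n" "v \<in> carrier_vec n"
  shows "(u + t \<cdot>\<^sub>v v) \<bullet> (C *\<^sub>v (u + t \<cdot>\<^sub>v v))
    = u \<bullet> (C *\<^sub>v u) + 2 * t * (u \<bullet> (C *\<^sub>v v)) + t * t * (v \<bullet> (C *\<^sub>v v))"
proof -
  have Cc: "C \<in> carrier_mat n n" using C by (rule symmetric_mat_carrier)
  have "v \<bullet> (C *\<^sub>v u) = u \<bullet> (C *\<^sub>v v)"
    using symmetric_mat_scalar_prod[OF C uv(2,1)] comm_scalar_prod[of "C *\<^sub>v v" n u] Cc uv by simp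
  then show ?thesis using Cc uv
    by (simp add: mult_add_distrib_mat_vec[of C n n] mult_mat_vec[of C n n]
        add_scalar_prod_distrib[of _ n] scalar_prod_add_distrib[of _ n] algebra_simps)
qed

lemma discriminant_le:
  fixes p \<alpha> \<beta> :: real
  assumes "\<alpha> \<ge> 0" and nonneg: "\<And>t. p + 2 * t * \<beta> + t * t * \<alpha> \<ge> 0"
  shows "\<beta> * \<beta> \<le> p * \<alpha>"
proof (cases "\<alpha> = 0")
  case True
  have "\<beta> = 0"
  proof (rule ccontr)
    assume "\<beta> \<noteq> 0"
    \<comment> \<open>At this t the expression, now affine, equals -1.\<close>
    then show False using nonneg[of "- (p + 1) / (2 * \<beta>)"] True by (simp add: field_simps)
  qed
  then show ?thesis using True by simp
next
  case False
  then have "\<alpha> > 0" using assms(1) by simp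
  then show ?thesis using nonneg[of "- \<beta> / \<alpha>"] by (simp add: field_simps)
qed

lemma psd_Cauchy_Schwarz:
  assumes C: "symmetric_mat n C" "psd_mat n C" and uv: "u \<in> carrier_vec n" "v \<in> carrier_vec n"
  shows "(u \<bullet> (C *\<^sub>v v)) * (u \<bullet> (C *\<^sub>v v)) \<le> (u \<bullet> (C *\<^sub>v u)) * (v \<bullet> (C *\<^sub>v v))"
proof (rule discriminant_le)
  show "v \<bullet> (C *\<^sub>v v) \<ge> 0" using C(2) uv by (auto simp: psd_mat_def)
  fix t
  have "(u + t \<cdot>\<^sub>v v) \<bullet> (C *\<^sub>v (u + t \<cdot>\<^sub>v v)) \<ge> 0"
    using C(2) uv by (auto simp: psd_mat_def)
  then show "u \<bullet> (C *\<^sub>v u) + 2 * t * (u \<bullet> (C *\<^sub>v v)) + t * t * (v \<bullet> (C *\<^sub>v v)) \<ge> 0"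
    unfolding quadratic_form_add_smult[OF C(1) uv] .
qed

lemma vec_Cauchy_Schwarz:
  fixes u v :: "real vec"
  assumes uv: "u \<in> carrier_vec n" "v \<in> carrier_vec n"
  shows "(u \<bullet> v) * (u \<bullet> v) \<le> (u \<bullet> u) * (v \<bullet> v)"
  using psd_Cauchy_Schwarz[OF symmetric_mat_one _ uv] uv
  by (simp add: psd_mat_def scalar_prod_self_nonneg)

lemma scalar_prod_le_vnorm:
  assumes "u \<in> carrier_vec n" "v \<in> carrier_vec n"
  shows "\<bar>u \<bullet> v\<bar> \<le> vnorm u * vnorm v"
  unfolding vnorm_def real_sqrt_mult[symmetric]
  using vec_Cauchy_Schwarz[OF assms] by (intro real_le_rsqrt) (simp add: power2_eq_square)

lemma mult_mat_vec_bounded: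
  assumes C: "(C :: real mat) \<in> carrier_mat n n"
  obtains K where "K \<ge> 0" "\<And>v. v \<in> carrier_vec n \<Longrightarrow> (C *\<^sub>v v) \<bullet> (C *\<^sub>v v) \<le> K * (v \<bullet> v)"
proof
  \<comment> \<open>The squared Frobenius norm: Cauchy-Schwarz is applied to each row.\<close>
  let ?K = "\<Sum>i<n. row C i \<bullet> row C i"
  show "?K \<ge> 0" by (simp add: sum_nonneg scalar_prod_self_nonneg)
  fix v :: "real vec" assume v: "v \<in> carrier_vec n"
  have "(C *\<^sub>v v) \<bullet> (C *\<^sub>v v) = (\<Sum>i<n. (row C i \<bullet> v) * (row C i \<bullet> v))"
    using C by (simp add: scalar_prod_def[of "C *\<^sub>v v"] atLeast0LessThan)
  also have "\<dots> \<le> (\<Sum>i<n. (row C i \<bullet> row C i) * (v \<bullet> v))"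
    using C v by (intro sum_mono vec_Cauchy_Schwarz) auto
  finally show "(C *\<^sub>v v) \<bullet> (C *\<^sub>v v) \<le> ?K * (v \<bullet> v)" by (simp add: sum_distrib_right)
qed

lemma quadratic_form_bounded:
  assumes C: "(C :: real mat) \<in> carrier_mat n n"
  obtains K where "K > 0" "\<And>v. v \<in> carrier_vec n \<Longrightarrow> \<bar>v \<bullet> (C *\<^sub>v v)\<bar> \<le> K * (v \<bullet> v)"
proof -
  obtain K where K: "K \<ge> 0" "\<And>v. v \<in> carrier_vec n \<Longrightarrow> (C *\<^sub>v v) \<bullet> (C *\<^sub>v v) \<le> K * (v \<bullet> v)"
    using mult_mat_vec_bounded[OF C] by blast
  show ?thesis
  proof
    \<comment> \<open>The added 1 keeps the constant positive for the zero matrix too; its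
      reciprocal later serves as a definiteness constant.\<close>
    show "sqrt K + 1 > 0" using K by (simp add: add_nonneg_pos)
    fix v :: "real vec" assume v: "v \<in> carrier_vec n"
    have "\<bar>v \<bullet> (C *\<^sub>v v)\<bar> \<le> vnorm v * vnorm (C *\<^sub>v v)"
      using C v by (intro scalar_prod_le_vnorm[of _ n]) auto
    also have "vnorm (C *\<^sub>v v) \<le> sqrt (K * (v \<bullet> v))"
      unfolding vnorm_def using K v by simp
    also have "vnorm v * sqrt (K * (v \<bullet> v)) = sqrt K * (v \<bullet> v)"
      by (simp add: vnorm_def real_sqrt_mult scalar_prod_self_nonneg)
    also have "\<dots> \<le> (sqrt K + 1) * (v \<bullet> v)"
      using scalar_prod_self_nonneg[of v] by (simp add: algebra_simps)
    finally show "\<bar>v \<bullet> (C *\<^sub>v v)\<bar> \<le> (sqrt K + 1) * (v \<bullet> v)"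
      using scalar_prod_self_nonneg[of v] by (simp add: vnorm_def mult_left_mono)
  qed
qed

section \<open>Uniform definiteness and extreme eigenvalues\<close>

lemma det_nonzero_obtain_inverse:
  assumes C: "(C :: real mat) \<in> carrier_mat n n" and "det C \<noteq> 0"
  obtains D where "D \<in> carrier_mat n n" "C * D = 1\<^sub>m n" "D * C = 1\<^sub>m n"
  using det_non_zero_imp_unit[OF assms, of "()"] by (auto simp: Units_def ring_mat_def)

text \<open>Cauchy-Schwarz for the form of C, applied to v and to the solution w of C w = v.\<close>
lemma psd_invertible_imp_pd:
  assumes C: "symmetric_mat n C" "psd_mat n C" and "det C \<noteq> 0"
  obtains e where "e > 0" "\<And>v. v \<in> carrier_vec n \<Longrightarrow> e * (v \<bullet> v) \<le> v \<bullet> (C *\<^sub>v v)"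
proof -
  have Cc: "C \<in> carrier_mat n n" using C(1) by (rule symmetric_mat_carrier)
  obtain D where D: "D \<in> carrier_mat n n" "C * D = 1\<^sub>m n"
    using det_nonzero_obtain_inverse[OF Cc assms(3)] by blast
  obtain K where K: "K > 0" "\<And>v. v \<in> carrier_vec n \<Longrightarrow> \<bar>v \<bullet> (D *\<^sub>v v)\<bar> \<le> K * (v \<bullet> v)"
    using quadratic_form_bounded[OF D(1)] by blast
  show ?thesis
  proof
    show "1 / K > 0" using K by simp
    fix v :: "real vec" assume v: "v \<in> carrier_vec n"
    let ?w = "D *\<^sub>v v"
    have w: "?w \<in> carrier_vec n" using D v by simp
    have Cw: "C *\<^sub>v ?w = v" using assoc_mult_mat_vec[OF Cc D(1) v] D v by simp
    have nn: "v \<bullet> (C *\<^sub>v v) \<ge> 0" using C v by (auto simp: psd_mat_def)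
    have "(v \<bullet> v) * (v \<bullet> v) \<le> (v \<bullet> (C *\<^sub>v v)) * (?w \<bullet> v)"
      using psd_Cauchy_Schwarz[OF C v w] by (simp add: Cw)
    also have "\<dots> \<le> (v \<bullet> (C *\<^sub>v v)) * (K * (v \<bullet> v))"
      using K(2)[OF v] comm_scalar_prod[OF v w] nn by (intro mult_left_mono) auto
    finally have le: "(v \<bullet> v) * (v \<bullet> v) \<le> (K * (v \<bullet> (C *\<^sub>v v))) * (v \<bullet> v)" by (simp add: mult.assoc mult.left_commute)
    have "v \<bullet> v \<le> K * (v \<bullet> (C *\<^sub>v v))"
    proof (cases "v \<bullet> v = 0")
      case False
      then have "v \<bullet> v > 0" using scalar_prod_self_nonneg[of v] by linarith
      then show ?thesis using le by simp
    qed (use nn K in auto)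
    then show "1 / K * (v \<bullet> v) \<le> v \<bullet> (C *\<^sub>v v)" using K by (simp add: field_simps)
  qed
qed

text \<open>
  The largest \<open>\<mu>\<close> with \<open>A - \<mu> I\<close> positive semidefinite makes this matrix singular, because an invertible
  one would be uniformly positive definite.
\<close>
lemma rayleigh_infimum_eigenvalue:
  assumes A: "symmetric_mat n A" and n: "n > 0"
  obtains \<mu> where "eigenvalue A \<mu>" "\<And>v. v \<in> carrier_vec n \<Longrightarrow> \<mu> * (v \<bullet> v) \<le> v \<bullet> (A *\<^sub>v v)"
proof -
  have Ac: "A \<in> carrier_mat n n" using A by (rule symmetric_mat_carrier)
  define S where "S = {\<mu>. \<forall>v \<in> carrier_vec n. \<mu> * (v \<bullet> v) \<le> v \<bullet> (A *\<^sub>v v)}"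
  obtain K where K: "\<And>v. v \<in> carrier_vec n \<Longrightarrow> \<bar>v \<bullet> (A *\<^sub>v v)\<bar> \<le> K * (v \<bullet> v)"
    using quadratic_form_bounded[OF Ac] by blast
  have "- K \<in> S" unfolding S_def using K by (force simp: abs_le_iff)
  then have ne: "S \<noteq> {}" by auto
  have bdd: "bdd_above S"
  proof (rule bdd_aboveI)
    fix \<mu> assume "\<mu> \<in> S"
    then have "\<mu> * (unit_vec n 0 \<bullet> unit_vec n 0) \<le> unit_vec n 0 \<bullet> (A *\<^sub>v unit_vec n 0)"
      unfolding S_def by auto
    then show "\<mu> \<le> unit_vec n 0 \<bullet> (A *\<^sub>v unit_vec n 0)" using n by simp
  qed
  define \<mu> where "\<mu> = Sup S"
  have \<mu>: "\<mu> * (v \<bullet> v) \<le> v \<bullet> (A *\<^sub>v v)" if v: "v \<in> carrier_vec n" for v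
  proof (cases "v \<bullet> v = 0")
    case True
    then show ?thesis using K[OF v] by simp
  next
    case False
    then have pos: "v \<bullet> v > 0" using scalar_prod_self_nonneg[of v] by linarith
    have "\<mu> \<le> (v \<bullet> (A *\<^sub>v v)) / (v \<bullet> v)"
      unfolding \<mu>_def using ne pos v by (intro cSup_least) (auto simp: S_def field_simps)
    then show ?thesis using pos by (simp add: field_simps)
  qed
  let ?C = "A + (- \<mu>) \<cdot>\<^sub>m 1\<^sub>m n"
  have form: "v \<bullet> (?C *\<^sub>v v) = v \<bullet> (A *\<^sub>v v) - \<mu> * (v \<bullet> v)" if v: "v \<in> carrier_vec n" for v
    using v Ac by (simp add: shift_mult_vec scalar_prod_add_distrib[of _ n])
  have "det ?C = 0"
  proof (rule ccontr)
    assume "det ?C \<noteq> 0"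
    moreover have "psd_mat n ?C" using \<mu> by (simp add: psd_mat_def form)
    ultimately obtain e where e: "e > 0" "\<And>v. v \<in> carrier_vec n \<Longrightarrow> e * (v \<bullet> v) \<le> v \<bullet> (?C *\<^sub>v v)"
      using psd_invertible_imp_pd[OF symmetric_mat_shift[OF A]] by blast
    then have "\<mu> + e \<in> S" unfolding S_def by (force simp: form algebra_simps)
    then have "\<mu> + e \<le> \<mu>" unfolding \<mu>_def by (rule cSup_upper[OF _ bdd])
    then show False using e by simp
  qed
  then have "eigenvalue A \<mu>" using eigenvalue_det[OF Ac] Ac by (simp add: char_matrix_def)
  then show ?thesis using \<mu> that by blast
qed

lemma finite_eigenvalues:
  assumes "(A :: real mat) \<in> carrier_mat n n"
  shows "finite {a. eigenvalue A a}"
proof -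
  have "char_poly A \<noteq> 0" using degree_monic_char_poly[OF assms] by auto
  then have "finite {a. poly (char_poly A) a = 0}" by (rule poly_roots_finite)
  then show ?thesis using eigenvalue_root_char_poly[OF assms] by simp
qed

text \<open>Some eigenvalue lies below every Rayleigh quotient, hence so does the least one. The
  upper bound is the same argument for -A, whose eigenvalue \<nu> is the eigenvalue -\<nu> of A. No
  diagonalisation is involved.\<close>

lemma quadratic_form_eig_bounds:
  assumes A: "symmetric_mat n A" and n: "n > 0" and v: "v \<in> carrier_vec n"
  shows "min_eig A * (v \<bullet> v) \<le> v \<bullet> (A *\<^sub>v v)" "v \<bullet> (A *\<^sub>v v) \<le> max_eig A * (v \<bullet> v)"
proof -
  have Ac: "A \<in> carrier_mat n n" using A by (rule symmetric_mat_carrier)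
  note fin = finite_eigenvalues[OF Ac]
  obtain \<mu> where \<mu>: "eigenvalue A \<mu>" "\<mu> * (v \<bullet> v) \<le> v \<bullet> (A *\<^sub>v v)"
    using rayleigh_infimum_eigenvalue[OF A n] v by metis
  have "min_eig A \<le> \<mu>" unfolding min_eig_def using fin \<mu> by (intro Min_le) auto
  then show "min_eig A * (v \<bullet> v) \<le> v \<bullet> (A *\<^sub>v v)"
    using \<mu>(2) mult_right_mono[OF _ scalar_prod_self_nonneg[of v]] by fastforce
  have "symmetric_mat n (- A)" using A by (simp add: symmetric_mat_def transpose_uminus)
  then obtain \<nu> where \<nu>: "eigenvalue (- A) \<nu>" "\<nu> * (v \<bullet> v) \<le> v \<bullet> (- A *\<^sub>v v)"
    using rayleigh_infimum_eigenvalue[OF _ n] v by metis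
  from \<nu>(1) obtain z where z: "z \<in> carrier_vec n" "z \<noteq> 0\<^sub>v n" "- A *\<^sub>v z = \<nu> \<cdot>\<^sub>v z"
    using Ac by (auto simp: eigenvalue_def eigenvector_def)
  have "- (A *\<^sub>v z) = \<nu> \<cdot>\<^sub>v z" using z Ac by simp
  then have "A *\<^sub>v z = - (\<nu> \<cdot>\<^sub>v z)" by (metis uminus_uminus_vec)
  also have "\<dots> = (- \<nu>) \<cdot>\<^sub>v z" by auto
  finally have "eigenvalue A (- \<nu>)"
    using z Ac by (auto simp: eigenvalue_def eigenvector_def)
  then have "- \<nu> \<le> max_eig A" unfolding max_eig_def using fin by (intro Max_ge) auto
  moreover have "v \<bullet> (A *\<^sub>v v) \<le> - \<nu> * (v \<bullet> v)" using \<nu>(2) v Ac by simp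
  ultimately show "v \<bullet> (A *\<^sub>v v) \<le> max_eig A * (v \<bullet> v)"
    using mult_right_mono[OF _ scalar_prod_self_nonneg[of v]] by fastforce
qed

section \<open>Inverses and norms of positive definite matrices\<close>

lemma mat_inv_pd:
  assumes C: "(C :: real mat) \<in> carrier_mat n n" and "e > 0"
    and pd: "\<And>v. v \<in> carrier_vec n \<Longrightarrow> e * (v \<bullet> v) \<le> v \<bullet> (C *\<^sub>v v)"
  shows "mat_inv C \<in> carrier_mat n n"
    and "v \<in> carrier_vec n \<Longrightarrow> C *\<^sub>v (mat_inv C *\<^sub>v v) = v"
    and "v \<in> carrier_vec n \<Longrightarrow> mat_inv C *\<^sub>v (C *\<^sub>v v) = v"
proof -
  have "det C \<noteq> 0"
  proof
    assume "det C = 0"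
    then obtain z where z: "z \<in> carrier_vec n" "z \<noteq> 0\<^sub>v n" "C *\<^sub>v z = 0\<^sub>v n"
      using det_0_iff_vec_prod_zero[OF C] by auto
    then have "e * (z \<bullet> z) \<le> 0" using pd[of z] by simp
    then have "z \<bullet> z = 0"
      using \<open>e > 0\<close> scalar_prod_self_nonneg[of z] by (simp add: mult_le_0_iff)
    then show False using scalar_prod_self_eq_0 z by blast
  qed
  \<comment> \<open>\<open>mat_inv\<close> is a choice; definiteness excludes a kernel, so a
    two-sided inverse exists and the chosen matrix is one.\<close>
  then have "\<exists>D. D \<in> carrier_mat (dim_col C) (dim_row C) \<and> inverts_mat C D \<and> inverts_mat D C"
    using C by (elim det_nonzero_obtain_inverse[OF C]) (auto simp: inverts_mat_def)
  then have "mat_inv C \<in> carrier_mat (dim_col C) (dim_row C) \<and> inverts_mat C (mat_inv C)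
      \<and> inverts_mat (mat_inv C) C"
    unfolding mat_inv_def by (rule someI_ex)
  then have D: "mat_inv C \<in> carrier_mat n n" "C * mat_inv C = 1\<^sub>m n" "mat_inv C * C = 1\<^sub>m n"
    using C by (auto simp: inverts_mat_def)
  show "mat_inv C \<in> carrier_mat n n" by (rule D)
  show "C *\<^sub>v (mat_inv C *\<^sub>v v) = v" if "v \<in> carrier_vec n"
    using assoc_mult_mat_vec[OF C D(1) that] D that by simp
  show "mat_inv C *\<^sub>v (C *\<^sub>v v) = v" if "v \<in> carrier_vec n"
    using assoc_mult_mat_vec[OF D(1) C that] D that by simp
qed

lemma vnorm_sq: "vnorm v * vnorm v = v \<bullet> v"
  by (simp add: vnorm_def scalar_prod_self_nonneg)

lemma vnorm_pos:
  assumes "v \<in> carrier_vec n" "v \<noteq> 0\<^sub>v n"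
  shows "vnorm v > 0"
  using scalar_prod_self_eq_0[OF assms(1)] assms(2) scalar_prod_self_nonneg[of v]
  by (force simp: vnorm_def)

lemma vnorm_smult: "vnorm (c \<cdot>\<^sub>v v) = \<bar>c\<bar> * vnorm v"
  by (simp add: vnorm_def real_sqrt_mult flip: mult.assoc)

lemma mult_mat_vec_uminus:
  assumes "(C :: real mat) \<in> carrier_mat n m" "v \<in> carrier_vec m"
  shows "C *\<^sub>v (- v) = - (C *\<^sub>v v)"
  using assms by (intro eq_vecI) auto

text \<open>Cauchy-Schwarz in the form of C, applied to v and C v, bounds |C v|^4 by b^2 |v|^2 |C
  v|^2.\<close>

lemma mult_mat_vec_norm_le:
  assumes C: "symmetric_mat n C" and psd: "psd_mat n C" and b: "b \<ge> 0"
    and upper: "\<And>v. v \<in> carrier_vec n \<Longrightarrow> v \<bullet> (C *\<^sub>v v) \<le> b * (v \<bullet> v)"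
    and v: "v \<in> carrier_vec n"
  shows "vnorm (C *\<^sub>v v) \<le> b * vnorm v"
proof -
  note Cc = symmetric_mat_carrier[OF C]
  let ?u = "C *\<^sub>v v"
  have u: "?u \<in> carrier_vec n" using Cc v by simp
  have "(?u \<bullet> ?u) * (?u \<bullet> ?u) = (v \<bullet> (C *\<^sub>v ?u)) * (v \<bullet> (C *\<^sub>v ?u))"
    using symmetric_mat_scalar_prod[OF C v u] by simp
  also have "\<dots> \<le> (v \<bullet> (C *\<^sub>v v)) * (?u \<bullet> (C *\<^sub>v ?u))"
    by (rule psd_Cauchy_Schwarz[OF C psd v u])
  also have "\<dots> \<le> (b * (v \<bullet> v)) * (b * (?u \<bullet> ?u))"
    using upper[OF v] upper[OF u] psd u b scalar_prod_self_nonneg[of v]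
    by (intro mult_mono) (auto simp: psd_mat_def)
  finally have le: "(?u \<bullet> ?u) * (?u \<bullet> ?u) \<le> (b * b * (v \<bullet> v)) * (?u \<bullet> ?u)" by (simp add: mult.assoc mult.left_commute)
  have "?u \<bullet> ?u \<le> b * b * (v \<bullet> v)"
  proof (cases "?u \<bullet> ?u = 0")
    case False
    then have "?u \<bullet> ?u > 0" using scalar_prod_self_nonneg[of ?u] by linarith
    then show ?thesis using le by (simp only: mult_le_cancel_right_pos)
  qed (use b scalar_prod_self_nonneg[of v] in simp)
  then have "vnorm ?u \<le> sqrt (b * b * (v \<bullet> v))" by (simp add: vnorm_def)
  then show ?thesis using b by (simp add: vnorm_def real_sqrt_mult)
qed

text \<open>The quadrature bound contains 1/b, the final one the reciprocal of the operator norm;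
  these two facts allow the replacement.\<close>

lemma opnorm_pd_bounds:
  assumes C: "symmetric_mat n C" and n: "n > 0" and a: "a > 0"
    and lower: "\<And>v. v \<in> carrier_vec n \<Longrightarrow> a * (v \<bullet> v) \<le> v \<bullet> (C *\<^sub>v v)"
    and upper: "\<And>v. v \<in> carrier_vec n \<Longrightarrow> v \<bullet> (C *\<^sub>v v) \<le> b * (v \<bullet> v)"
  shows "0 < opnorm C" "opnorm C \<le> b"
proof -
  note Cc = symmetric_mat_carrier[OF C]
  let ?e = "unit_vec n 0 :: real vec"
  have e: "?e \<in> carrier_vec n" "?e \<bullet> ?e = 1" using n by auto
  have b: "b > 0" using lower[OF e(1)] upper[OF e(1)] e a by simp
  have psd: "psd_mat n C" unfolding psd_mat_def
    using lower a scalar_prod_self_nonneg by (meson mult_nonneg_nonneg less_imp_le order_trans)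
  let ?S = "{vnorm (C *\<^sub>v x) | x. x \<in> carrier_vec (dim_col C) \<and> vnorm x \<le> 1}"
  have in_S: "vnorm (C *\<^sub>v ?e) \<in> ?S" using Cc e by (auto simp: vnorm_def)
  have le: "s \<le> b" if "s \<in> ?S" for s
  proof -
    obtain x where x: "s = vnorm (C *\<^sub>v x)" "x \<in> carrier_vec n" "vnorm x \<le> 1"
      using \<open>s \<in> ?S\<close> Cc by auto
    have "s \<le> b * vnorm x"
      unfolding x(1) using b upper x by (intro mult_mat_vec_norm_le[OF C psd]) auto
    also have "\<dots> \<le> b * 1" using x b by (intro mult_left_mono) auto
    finally show ?thesis by simp
  qed
  show "opnorm C \<le> b" unfolding opnorm_def using in_S le by (intro cSup_least) auto
  have "0 < ?e \<bullet> (C *\<^sub>v ?e)" using lower[OF e(1)] e a by simp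
  then have "C *\<^sub>v ?e \<noteq> 0\<^sub>v n" using e by auto
  then have "0 < vnorm (C *\<^sub>v ?e)" using Cc e by (intro vnorm_pos[of _ n]) auto
  also have "\<dots> \<le> opnorm C" unfolding opnorm_def
    using in_S le by (intro cSup_upper bdd_aboveI[of _ b]) auto
  finally show "0 < opnorm C" .
qed

section \<open>Powers of a matrix applied to a vector, and their moments\<close>

lemma funpow_mult_mat_vec_carrier:
  "(C :: real mat) \<in> carrier_mat n n \<Longrightarrow> w \<in> carrier_vec n \<Longrightarrow> ((*\<^sub>v) C ^^ i) w \<in> carrier_vec n"
  by (induction i) auto

lemma pow_mat_mult_vec:
  assumes C: "(C :: real mat) \<in> carrier_mat n n" and w: "w \<in> carrier_vec n"
  shows "(C ^\<^sub>m i) *\<^sub>v w = ((*\<^sub>v) C ^^ i) w"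
  using w
proof (induction i arbitrary: w)
  case (Suc i)
  then have "(C ^\<^sub>m Suc i) *\<^sub>v w = (C ^\<^sub>m i) *\<^sub>v (C *\<^sub>v w)"
    using C by (simp add: assoc_mult_mat_vec[of _ n n _ n])
  also have "\<dots> = ((*\<^sub>v) C ^^ i) (C *\<^sub>v w)" using Suc C by simp
  finally show ?case by (simp add: funpow_swap1)
qed (use C in simp)

lemma symmetric_funpow_scalar_prod:
  assumes C: "symmetric_mat n C" and uv: "u \<in> carrier_vec n" "v \<in> carrier_vec n"
  shows "((*\<^sub>v) C ^^ i) u \<bullet> ((*\<^sub>v) C ^^ j) v = u \<bullet> ((*\<^sub>v) C ^^ (i + j)) v"
  using uv
proof (induction i arbitrary: u)
  case (Suc i)
  note Cc = symmetric_mat_carrier[OF C]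
  have "((*\<^sub>v) C ^^ Suc i) u \<bullet> ((*\<^sub>v) C ^^ j) v = (C *\<^sub>v u) \<bullet> ((*\<^sub>v) C ^^ (i + j)) v"
    using Suc Cc by (simp add: funpow_swap1)
  also have "\<dots> = u \<bullet> (C *\<^sub>v ((*\<^sub>v) C ^^ (i + j)) v)"
    using symmetric_mat_scalar_prod[OF C] Suc.prems funpow_mult_mat_vec_carrier[OF Cc] by simp
  finally show ?case by simp
qed simp

lemma scalar_prod_vec_sum:
  assumes "\<And>j. j \<in> S \<Longrightarrow> f j \<in> carrier_vec n" "(z :: real vec) \<in> carrier_vec n"
  shows "vec n (\<lambda>t. \<Sum>j\<in>S. c j * f j $ t) \<bullet> z = (\<Sum>j\<in>S. c j * (f j \<bullet> z))"
proof -
  have "vec n (\<lambda>t. \<Sum>j\<in>S. c j * f j $ t) \<bullet> z = (\<Sum>t<n. \<Sum>j\<in>S. c j * (f j $ t * z $ t))"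
    using assms by (simp add: scalar_prod_def sum_distrib_right atLeast0LessThan mult.assoc)
  also have "\<dots> = (\<Sum>j\<in>S. \<Sum>t<n. c j * (f j $ t * z $ t))" by (rule sum.swap)
  finally show ?thesis using assms
    by (simp add: scalar_prod_def sum_distrib_left atLeast0LessThan)
qed

lemma moment_fun_pCons_0: "moment_fun m (pCons 0 p) = moment_fun (\<lambda>i. m (Suc i)) p"
proof -
  have "moment_fun m (pCons 0 p) = (\<Sum>i\<le>Suc (degree p). coeff (pCons 0 p) i * m i)"
    by (rule moment_fun_upto) (rule degree_pCons_le)
  then show ?thesis by (simp add: sum.atMost_Suc_shift moment_fun_def del: sum.atMost_Suc)
qed

text \<open>With u = q(C) w, the functional takes the values u . u at q^2 and u . C u at X q^2, so
  the form bounds at u are exactly the required positivity.\<close>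

lemma moments_on_quadratic_form:
  assumes C: "symmetric_mat n C" and w: "w \<in> carrier_vec n"
    and lower: "\<And>v. v \<in> carrier_vec n \<Longrightarrow> a * (v \<bullet> v) \<le> v \<bullet> (C *\<^sub>v v)"
    and upper: "\<And>v. v \<in> carrier_vec n \<Longrightarrow> v \<bullet> (C *\<^sub>v v) \<le> b * (v \<bullet> v)"
  shows "moments_on a b (\<lambda>i. w \<bullet> ((*\<^sub>v) C ^^ i) w)"
proof -
  note Cc = symmetric_mat_carrier[OF C]
  let ?m = "\<lambda>i. w \<bullet> ((*\<^sub>v) C ^^ i) w"
  have pw: "((*\<^sub>v) C ^^ i) w \<in> carrier_vec n" for i by (rule funpow_mult_mat_vec_carrier[OF Cc w])
  show ?thesis unfolding moments_on_def
  proof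
    fix q :: "real poly"
    define u where "u = vec n (\<lambda>t. \<Sum>j\<le>degree q. coeff q j * ((*\<^sub>v) C ^^ j) w $ t)"
    have u: "u \<in> carrier_vec n" by (simp add: u_def)
    have ip: "u \<bullet> z = (\<Sum>j\<le>degree q. coeff q j * (((*\<^sub>v) C ^^ j) w \<bullet> z))" if "z \<in> carrier_vec n" for z
      unfolding u_def by (rule scalar_prod_vec_sum) (use pw that in auto)
    have ip': "((*\<^sub>v) C ^^ j) w \<bullet> u = (\<Sum>i\<le>degree q. coeff q i * ?m (i + j))" for j
      using ip[OF pw[of j]] comm_scalar_prod[OF pw u] symmetric_funpow_scalar_prod[OF C w w] by simp
    have uu: "u \<bullet> u = moment_fun ?m (q * q)"
      unfolding ip[OF u] ip' moment_fun_mult by (simp add: sum_distrib_left mult.assoc add.commute)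
    have "((*\<^sub>v) C ^^ j) w \<bullet> (C *\<^sub>v u) = ((*\<^sub>v) C ^^ Suc j) w \<bullet> u" for j
      using symmetric_mat_scalar_prod[OF C pw u] by simp
    then have uCu: "u \<bullet> (C *\<^sub>v u) = moment_fun ?m (pCons 0 (q * q))"
      unfolding moment_fun_pCons_0 moment_fun_mult using ip[of "C *\<^sub>v u"] Cc u
      by (simp only: ip' mult_mat_vec_carrier[OF Cc u]) (simp add: sum_distrib_left mult.assoc add.commute)
    have "q * q * [:-a, 1:] = pCons 0 (q * q) - Polynomial.smult a (q * q)"
      "q * q * [:b, -1:] = Polynomial.smult b (q * q) - pCons 0 (q * q)" by (simp_all)
    then have "moment_fun ?m (q * q * [:-a, 1:]) = u \<bullet> (C *\<^sub>v u) - a * (u \<bullet> u)"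
      "moment_fun ?m (q * q * [:b, -1:]) = b * (u \<bullet> u) - u \<bullet> (C *\<^sub>v u)"
      by (simp_all only: moment_fun_diff moment_fun_smult uu uCu)
    then show "moment_fun ?m (q * q) \<ge> 0 \<and> moment_fun ?m (q * q * [:-a, 1:]) \<ge> 0
        \<and> moment_fun ?m (q * q * [:b, -1:]) \<ge> 0"
      using lower[OF u] upper[OF u] scalar_prod_self_nonneg[of u] uu by simp
  qed
qed

text \<open>This is the form of T (T + \<mu> I), a product of commuting semidefinite matrices. In
  place of a square root, for \<mu> < 0, the proof combines (z . T z)^2 \<le> |z|^2 |T z|^2 with z .
  T z \<ge> -\<mu> |z|^2.\<close>

lemma psd_shift_mult_bound:
  assumes T: "symmetric_mat n T" and psd: "psd_mat n T" "psd_mat n (T + \<mu> \<cdot>\<^sub>m 1\<^sub>m n)"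
    and z: "z \<in> carrier_vec n"
  shows "(T *\<^sub>v z) \<bullet> (T *\<^sub>v z) + \<mu> * (z \<bullet> (T *\<^sub>v z)) \<ge> 0"
proof -
  note Tc = symmetric_mat_carrier[OF T]
  let ?p = "z \<bullet> (T *\<^sub>v z)" and ?r = "(T *\<^sub>v z) \<bullet> (T *\<^sub>v z)"
  have Tz: "T *\<^sub>v z \<in> carrier_vec n" using Tc z by simp
  have p: "?p \<ge> 0" using psd z by (auto simp: psd_mat_def)
  have r: "?r \<ge> 0" by (rule scalar_prod_self_nonneg)
  have shift: "?p + \<mu> * (z \<bullet> z) \<ge> 0"
    using psd(2) z Tc Tz unfolding psd_mat_def
    by (force simp: shift_mult_vec scalar_prod_add_distrib[of _ n])
  show ?thesis
  proof (cases "\<mu> \<ge> 0 \<or> ?p = 0")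
    case True
    then show ?thesis using p r by auto
  next
    case False
    then have "?p > 0" "\<mu> < 0" using p by auto
    have "- \<mu> * (?p * ?p) \<le> - \<mu> * ((z \<bullet> z) * ?r)"
      using vec_Cauchy_Schwarz[OF z Tz] \<open>\<mu> < 0\<close> by (intro mult_left_mono) auto
    also have "\<dots> = (- \<mu> * (z \<bullet> z)) * ?r" by simp
    also have "\<dots> \<le> ?p * ?r" using shift r by (intro mult_right_mono) auto
    finally have "?p * (- \<mu> * ?p) \<le> ?p * ?r" by (simp add: mult.left_commute)
    then have "- \<mu> * ?p \<le> ?r" using \<open>?p > 0\<close> by (simp only: mult_le_cancel_left_pos)
    then show ?thesis by linarith
  qed
qed

text \<open>
  Writing \<open>h = T (T z)\<close>, the difference of the two sides is
  \<open>\<mu>\<^sup>2 (3 \<parallel>T z\<parallel>\<^sup>2 + 2 \<mu> (z \<bullet> T z))\<close>.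
\<close>
lemma shifted_solution_norm_convex:
  assumes T: "symmetric_mat n T" and e: "e > 0"
    and pd: "\<And>v. v \<in> carrier_vec n \<Longrightarrow> e * (v \<bullet> v) \<le> v \<bullet> (T *\<^sub>v v)"
    and w: "w \<in> carrier_vec n" and h: "h \<in> carrier_vec n"
    and eq: "(T + \<mu> \<cdot>\<^sub>m 1\<^sub>m n) *\<^sub>v h = T *\<^sub>v (T *\<^sub>v w)"
    and psd: "psd_mat n (T + \<mu> \<cdot>\<^sub>m 1\<^sub>m n)"
  shows "(T *\<^sub>v w) \<bullet> (T *\<^sub>v w) - 2 * \<mu> * (w \<bullet> (T *\<^sub>v w)) \<le> h \<bullet> h"
proof -
  note Tc = symmetric_mat_carrier[OF T]
  note inv = mat_inv_pd[OF Tc e pd]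
  \<comment> \<open>u and z are T^-1 h and T^-2 h. Only T is inverted, since T + \<mu> I may be
    singular.\<close>
  define u where "u = mat_inv T *\<^sub>v h"
  define z where "z = mat_inv T *\<^sub>v u"
  have u: "u \<in> carrier_vec n" "T *\<^sub>v u = h" and z: "z \<in> carrier_vec n" "T *\<^sub>v z = u"
    using inv h by (auto simp: u_def z_def)
  have psdT: "psd_mat n T" unfolding psd_mat_def
    using pd e scalar_prod_self_nonneg by (meson mult_nonneg_nonneg less_imp_le order_trans)
  have inj: "v = v'" if "T *\<^sub>v v = T *\<^sub>v v'" "v \<in> carrier_vec n" "v' \<in> carrier_vec n" for v v'
    using that inv(3) by metis
  \<comment> \<open>Cancelling one factor T and then another expresses T w and w through h, u and z;
    the rest is expansion.\<close>
  have "T *\<^sub>v (h + \<mu> \<cdot>\<^sub>v u) = T *\<^sub>v (T *\<^sub>v w)"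
    using eq u h Tc by (simp add: shift_mult_vec mult_add_distrib_mat_vec[of _ n n] mult_mat_vec[of _ n n])
  then have x: "T *\<^sub>v w = h + \<mu> \<cdot>\<^sub>v u" using inj u h w Tc by (metis add_carrier_vec mult_mat_vec_carrier smult_carrier_vec)
  then have "T *\<^sub>v w = T *\<^sub>v (u + \<mu> \<cdot>\<^sub>v z)"
    using u z Tc by (simp add: mult_add_distrib_mat_vec[of _ n n] mult_mat_vec[of _ n n])
  then have w': "w = u + \<mu> \<cdot>\<^sub>v z" using inj u z w by simp
  have zh: "z \<bullet> h = u \<bullet> u" using symmetric_mat_scalar_prod[OF T z(1) u(1)] z u by simp
  have hu: "h \<bullet> u = u \<bullet> h" using comm_scalar_prod[OF h u(1)] .
  have "(T *\<^sub>v w) \<bullet> (T *\<^sub>v w) = h \<bullet> h + 2 * \<mu> * (u \<bullet> h) + \<mu> * \<mu> * (u \<bullet> u)"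
    unfolding x using h u hu
    by (simp add: add_scalar_prod_distrib[of _ n] scalar_prod_add_distrib[of _ n] algebra_simps)
  moreover have "w \<bullet> (T *\<^sub>v w) = u \<bullet> h + 2 * \<mu> * (u \<bullet> u) + \<mu> * \<mu> * (z \<bullet> u)"
    unfolding x unfolding w' using h u z zh
    by (simp add: add_scalar_prod_distrib[of _ n] scalar_prod_add_distrib[of _ n] algebra_simps)
  ultimately have "h \<bullet> h - ((T *\<^sub>v w) \<bullet> (T *\<^sub>v w) - 2 * \<mu> * (w \<bullet> (T *\<^sub>v w)))
      = \<mu> * \<mu> * (u \<bullet> u + 2 * (u \<bullet> u + \<mu> * (z \<bullet> u)))" by (simp add: algebra_simps)
  moreover have "u \<bullet> u + \<mu> * (z \<bullet> u) \<ge> 0"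
    using psd_shift_mult_bound[OF T psdT psd z(1)] z(2) by simp
  then have "\<mu> * \<mu> * (u \<bullet> u + 2 * (u \<bullet> u + \<mu> * (z \<bullet> u))) \<ge> 0"
    using scalar_prod_self_nonneg[of u] by (intro mult_nonneg_nonneg[OF zero_le_square]) simp
  ultimately show ?thesis by linarith
qed

section \<open>Krylov spaces and the Lanczos projection\<close>

lemma Qmat_carrier: "Qmat n k q \<in> carrier_mat n k"
  by (simp add: Qmat_def mat_of_cols_def)

lemma Qmat_mult_vec:
  assumes "\<And>l. l < k \<Longrightarrow> q l \<in> carrier_vec n" "c \<in> carrier_vec k"
  shows "Qmat n k q *\<^sub>v c = vec n (\<lambda>i. \<Sum>l<k. c $ l * q l $ i)"
  using assms
  by (intro eq_vecI) (auto simp: Qmat_def scalar_prod_def mat_of_cols_def atLeast0LessThan mult.commute intro!: sum.cong)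

lemma krylov_mono:
  assumes "i \<le> j"
  shows "krylov n A g i \<subseteq> krylov n A g j"
proof
  fix v assume "v \<in> krylov n A g i"
  then obtain c where v: "v = vec n (\<lambda>t. \<Sum>l<i. c l * ((A ^\<^sub>m l) *\<^sub>v g) $ t)"
    unfolding krylov_def lspan_def by blast
  have "v = vec n (\<lambda>t. \<Sum>l<j. (if l < i then c l else 0) * ((A ^\<^sub>m l) *\<^sub>v g) $ t)"
    unfolding v using assms
    by (intro eq_vecI) (auto intro!: sum.mono_neutral_cong_left split: if_splits)
  then have "\<exists>d. v = vec n (\<lambda>t. \<Sum>l<j. d l * ((A ^\<^sub>m l) *\<^sub>v g) $ t)"
    by (rule exI[of _ "\<lambda>l. if l < i then c l else 0"])
  then show "v \<in> krylov n A g j" unfolding krylov_def lspan_def by blast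
qed

lemma krylov_shift_mult:
  assumes A: "A \<in> carrier_mat n n" and g: "g \<in> carrier_vec n" and v: "v \<in> krylov n A g j"
  shows "(A + l \<cdot>\<^sub>m 1\<^sub>m n) *\<^sub>v v \<in> krylov n A g (Suc j)"
proof -
  let ?p = "\<lambda>i. ((*\<^sub>v) A ^^ i) g"
  note pw = funpow_mult_mat_vec_carrier[OF A g]
  obtain c where v: "v = vec n (\<lambda>t. \<Sum>i<j. c i * ?p i $ t)"
    using v unfolding krylov_def lspan_def pow_mat_mult_vec[OF A g] by blast
  have vc: "v \<in> carrier_vec n" by (simp add: v)
  \<comment> \<open>Coefficients of (X + l) times the polynomial with coefficients c; the guard at 0
    is for the truncated \<open>i - 1\<close>.\<close>
  define d where "d = (\<lambda>i. (if i = 0 then 0 else c (i - 1)) + l * (if i < j then c i else 0))"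
  have "(A + l \<cdot>\<^sub>m 1\<^sub>m n) *\<^sub>v v = vec n (\<lambda>t. \<Sum>i<Suc j. d i * ?p i $ t)"
  proof (rule eq_vecI)
    fix t assume "t < dim_vec (vec n (\<lambda>t. \<Sum>i<Suc j. d i * ?p i $ t))"
    then have t: "t < n" by simp
    have rc: "row A t \<in> carrier_vec n" using A t by auto
    have "(A *\<^sub>v v) $ t = v \<bullet> row A t"
      using A t vc by (simp add: comm_scalar_prod[OF rc vc])
    also have "\<dots> = (\<Sum>i<j. c i * (?p i \<bullet> row A t))"
      unfolding v by (rule scalar_prod_vec_sum) (use pw rc in auto)
    also have "\<dots> = (\<Sum>i<j. c i * ?p (Suc i) $ t)"
      using A t comm_scalar_prod[OF rc pw] by (intro sum.cong) auto
    also have "\<dots> = (\<Sum>i<Suc j. (if i = 0 then 0 else c (i - 1)) * ?p i $ t)"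
      by (subst sum.lessThan_Suc_shift) simp
    finally have "((A + l \<cdot>\<^sub>m 1\<^sub>m n) *\<^sub>v v) $ t
        = (\<Sum>i<Suc j. (if i = 0 then 0 else c (i - 1)) * ?p i $ t) + l * (\<Sum>i<j. c i * ?p i $ t)"
      using A t vc by (subst shift_mult_vec[OF A vc]) (simp add: v)
    also have "(\<Sum>i<j. c i * ?p i $ t) = (\<Sum>i<Suc j. (if i < j then c i else 0) * ?p i $ t)"
      by simp
    finally show "((A + l \<cdot>\<^sub>m 1\<^sub>m n) *\<^sub>v v) $ t = vec n (\<lambda>t. \<Sum>i<Suc j. d i * ?p i $ t) $ t"
      using t by (simp only: index_vec d_def distrib_right sum.distrib sum_distrib_left mult.assoc)
  qed (use A in simp)
  then show ?thesis unfolding krylov_def lspan_def pow_mat_mult_vec[OF A g] by blast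
qed

text \<open>Krylov spaces do not change when a multiple of the identity is added to the
  matrix.\<close>

lemma funpow_shift_in_krylov:
  assumes A: "A \<in> carrier_mat n n" and g: "g \<in> carrier_vec n"
  shows "((*\<^sub>v) (A + l \<cdot>\<^sub>m 1\<^sub>m n) ^^ j) g \<in> krylov n A g (Suc j)"
proof (induction j)
  case 0
  have "g = vec n (\<lambda>i. \<Sum>l<Suc 0. 1 * ((A ^\<^sub>m l) *\<^sub>v g) $ i)"
    using A g by (intro eq_vecI) auto
  then show ?case unfolding krylov_def lspan_def by (auto intro!: exI[of _ "\<lambda>_. 1"])
next
  case (Suc j)
  then show ?case using krylov_shift_mult[OF A g] by simp
qed

context
  fixes n k :: nat and A :: "real mat" and g :: "real vec" and q :: "nat \<Rightarrow> real vec"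
  assumes A: "symmetric_mat n A" and g: "g \<in> carrier_vec n" "g \<noteq> 0\<^sub>v n"
    and k: "1 \<le> k" and lanczos: "lanczos_vecs n A g k q"
begin

lemma lanczos_carrier: "i < k \<Longrightarrow> q i \<in> carrier_vec n"
  using lanczos by (simp add: lanczos_vecs_def)

lemma Qmat_orthonormal:
  assumes "c \<in> carrier_vec k"
  shows "transpose_mat (Qmat n k q) *\<^sub>v (Qmat n k q *\<^sub>v c) = c"
proof -
  note Q = Qmat_carrier[of n k q]
  have "transpose_mat (Qmat n k q) * Qmat n k q = 1\<^sub>m k"
    using Q lanczos lanczos_carrier
    by (intro eq_matI) (auto simp: lanczos_vecs_def Qmat_def)
  then show ?thesis
    using assoc_mult_mat_vec[of "transpose_mat (Qmat n k q)" k n "Qmat n k q" k c] Q assms by simp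
qed

lemma Qmat_scalar_prod:
  assumes "u \<in> carrier_vec k" "z \<in> carrier_vec n"
  shows "u \<bullet> (transpose_mat (Qmat n k q) *\<^sub>v z) = (Qmat n k q *\<^sub>v u) \<bullet> z"
  using transpose_vec_mult_scalar[OF Qmat_carrier assms] Qmat_carrier[of n k q] assms
    comm_scalar_prod[of u k "transpose_mat (Qmat n k q) *\<^sub>v z"] comm_scalar_prod[of "Qmat n k q *\<^sub>v u" n z]
  by simp

lemma Qmat_isometry:
  assumes "u \<in> carrier_vec k" "v \<in> carrier_vec k"
  shows "(Qmat n k q *\<^sub>v u) \<bullet> (Qmat n k q *\<^sub>v v) = u \<bullet> v"
  using Qmat_scalar_prod[of u "Qmat n k q *\<^sub>v v"] Qmat_orthonormal Qmat_carrier[of n k q] assms by simp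

text \<open>The Krylov space is the range of Q, and Q Q^T fixes that range because Q^T Q =
  I.\<close>

lemma Qmat_projection:
  assumes "v \<in> krylov n A g k"
  shows "Qmat n k q *\<^sub>v (transpose_mat (Qmat n k q) *\<^sub>v v) = v"
proof -
  have "lspan n q k = krylov n A g k" using lanczos k by (simp add: lanczos_vecs_def)
  then obtain c where "v = vec n (\<lambda>i. \<Sum>l<k. c l * q l $ i)"
    using assms unfolding lspan_def by blast
  then have "v = Qmat n k q *\<^sub>v vec k c"
    using Qmat_mult_vec[of k q n "vec k c"] lanczos_carrier by simp
  then show ?thesis using Qmat_orthonormal[of "vec k c"] by simp
qed

lemma Qmat_first: "Qmat n k q *\<^sub>v (vnorm g \<cdot>\<^sub>v unit_vec k 0) = g"
proof -
  have "Qmat n k q *\<^sub>v (vnorm g \<cdot>\<^sub>v unit_vec k 0) = vec n (\<lambda>i. \<Sum>l<k. (vnorm g \<cdot>\<^sub>v unit_vec k 0) $ l * q l $ i)"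
    using lanczos_carrier by (intro Qmat_mult_vec) auto
  also have "\<dots> = vec n (\<lambda>i. \<Sum>l\<in>{0}. vnorm g * q l $ i)"
    using k by (intro arg_cong[where f = "vec n"] ext sum.mono_neutral_cong_right) auto
  also have "\<dots> = g"
    using lanczos vnorm_pos[OF g] g by (intro eq_vecI) (auto simp: lanczos_vecs_def)
  finally show ?thesis .
qed

lemma Tmat_carrier: "Tmat n k q A \<in> carrier_mat k k"
  using Qmat_carrier[of n k q] symmetric_mat_carrier[OF A] by (simp add: Tmat_def)

lemma symmetric_Tmat: "symmetric_mat k (Tmat n k q A)"
proof -
  note Q = Qmat_carrier[of n k q] and Ac = symmetric_mat_carrier[OF A]
  have "transpose_mat (Tmat n k q A) = transpose_mat (Qmat n k q) * (A * Qmat n k q)"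
    unfolding Tmat_def using Q Ac A
    by (simp add: transpose_mult[of _ k n _ k] transpose_mult[of _ k n _ n] transpose_mult[of _ n n _ k]
        assoc_mult_mat[of _ k n _ n _ k] symmetric_mat_def)
  also have "\<dots> = Tmat n k q A" unfolding Tmat_def using Q Ac by (simp add: assoc_mult_mat[of _ k n _ n _ k])
  finally show ?thesis using Tmat_carrier by (simp add: symmetric_mat_def)
qed

text \<open>Q^T Q = I lets the shift pass through the compression, so the Lanczos process for A also
  serves the shifted matrix.\<close>

lemma Tmat_shift_mult_vec:
  assumes v: "v \<in> carrier_vec k"
  shows "(Tmat n k q A + l \<cdot>\<^sub>m 1\<^sub>m k) *\<^sub>v v
    = transpose_mat (Qmat n k q) *\<^sub>v ((A + l \<cdot>\<^sub>m 1\<^sub>m n) *\<^sub>v (Qmat n k q *\<^sub>v v))"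
proof -
  note Q = Qmat_carrier[of n k q] and Ac = symmetric_mat_carrier[OF A]
  have Qv: "Qmat n k q *\<^sub>v v \<in> carrier_vec n" using Q v by simp
  have "Tmat n k q A *\<^sub>v v = transpose_mat (Qmat n k q) *\<^sub>v (A *\<^sub>v (Qmat n k q *\<^sub>v v))"
    unfolding Tmat_def using Q Ac v Qv
    by (simp add: assoc_mult_mat_vec[of _ k n _ k] assoc_mult_mat_vec[of _ k n _ n])
  then show ?thesis
    using Q Ac v Qv Qmat_orthonormal[OF v] Tmat_carrier
    by (simp add: shift_mult_vec mult_add_distrib_mat_vec[of _ k n] mult_mat_vec[of _ k n])
qed

lemma Tmat_shift_form:
  assumes u: "u \<in> carrier_vec k" and v: "v \<in> carrier_vec k"
  shows "u \<bullet> ((Tmat n k q A + l \<cdot>\<^sub>m 1\<^sub>m k) *\<^sub>v v)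
    = (Qmat n k q *\<^sub>v u) \<bullet> ((A + l \<cdot>\<^sub>m 1\<^sub>m n) *\<^sub>v (Qmat n k q *\<^sub>v v))"
proof -
  note Q = Qmat_carrier[of n k q] and Bc = symmetric_mat_carrier[OF symmetric_mat_shift[OF A, of l]]
  show ?thesis unfolding Tmat_shift_mult_vec[OF v]
    by (intro Qmat_scalar_prod mult_mat_vec_carrier[OF Bc] mult_mat_vec_carrier[OF Q] u v)
qed

text \<open>Each step of T inserts the projection Q Q^T, which does nothing while the vector stays
  in the Krylov space. Power j needs dimension j + 1, hence j < k.\<close>

lemma Qmat_funpow_Tmat:
  fixes l :: real
  defines "T \<equiv> Tmat n k q A + l \<cdot>\<^sub>m 1\<^sub>m k" and "B \<equiv> A + l \<cdot>\<^sub>m 1\<^sub>m n"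
  assumes "j < k"
  shows "Qmat n k q *\<^sub>v (((*\<^sub>v) T ^^ j) (vnorm g \<cdot>\<^sub>v unit_vec k 0)) = ((*\<^sub>v) B ^^ j) g"
  using \<open>j < k\<close>
proof (induction j)
  case 0
  then show ?case using Qmat_first by simp
next
  case (Suc j)
  let ?c = "vnorm g \<cdot>\<^sub>v unit_vec k 0 :: real vec"
  have T: "T \<in> carrier_mat k k" using Tmat_carrier by (simp add: T_def)
  have c: "((*\<^sub>v) T ^^ j) ?c \<in> carrier_vec k" by (rule funpow_mult_mat_vec_carrier[OF T]) simp
  have "((*\<^sub>v) B ^^ Suc j) g \<in> krylov n A g (Suc (Suc j))"
    unfolding B_def by (rule funpow_shift_in_krylov[OF symmetric_mat_carrier[OF A] g(1)])
  then have kr: "((*\<^sub>v) B ^^ Suc j) g \<in> krylov n A g k" using krylov_mono[of "Suc (Suc j)" k] Suc.prems by auto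
  have "((*\<^sub>v) T ^^ Suc j) ?c
      = transpose_mat (Qmat n k q) *\<^sub>v (B *\<^sub>v (Qmat n k q *\<^sub>v (((*\<^sub>v) T ^^ j) ?c)))"
    using Tmat_shift_mult_vec[OF c, of l] by (simp add: T_def B_def)
  also have "\<dots> = transpose_mat (Qmat n k q) *\<^sub>v (((*\<^sub>v) B ^^ Suc j) g)" using Suc by simp
  finally show ?case using Qmat_projection[OF kr] by simp
qed

text \<open>Split the power between the two arguments, each share below k, where Q carries T-powers
  to B-powers isometrically. The top degree 2k - 1 = (k - 1) + 1 + (k - 1) leaves one factor in the
  middle, handled by the compressed form.\<close>

lemma gauss_quadrature_exact:
  fixes l :: real
  defines "T \<equiv> Tmat n k q A + l \<cdot>\<^sub>m 1\<^sub>m k" and "B \<equiv> A + l \<cdot>\<^sub>m 1\<^sub>m n"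
    and "c \<equiv> vnorm g \<cdot>\<^sub>v unit_vec k 0"
  assumes i: "i \<le> 2 * k - 1"
  shows "g \<bullet> ((*\<^sub>v) B ^^ i) g = c \<bullet> ((*\<^sub>v) T ^^ i) c"
proof -
  have T: "symmetric_mat k T" and B: "symmetric_mat n B"
    unfolding T_def B_def by (intro symmetric_mat_shift symmetric_Tmat A)+
  have c: "c \<in> carrier_vec k" by (simp add: c_def)
  have pw: "((*\<^sub>v) T ^^ j) c \<in> carrier_vec k" for j
    by (rule funpow_mult_mat_vec_carrier[OF symmetric_mat_carrier[OF T] c])
  have Q: "Qmat n k q *\<^sub>v (((*\<^sub>v) T ^^ j) c) = ((*\<^sub>v) B ^^ j) g" if "j < k" for j
    unfolding T_def B_def c_def by (rule Qmat_funpow_Tmat[OF that])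
  show ?thesis
  proof (cases "i = 2 * k - 1")
    case True
    then have i: "i = (k - 1) + Suc (k - 1)" using k by simp
    have "g \<bullet> ((*\<^sub>v) B ^^ i) g = ((*\<^sub>v) B ^^ (k - 1)) g \<bullet> (B *\<^sub>v ((*\<^sub>v) B ^^ (k - 1)) g)"
      unfolding i symmetric_funpow_scalar_prod[OF B g(1) g(1), symmetric] by simp
    also have "\<dots> = ((*\<^sub>v) T ^^ (k - 1)) c \<bullet> (T *\<^sub>v ((*\<^sub>v) T ^^ (k - 1)) c)"
      using Tmat_shift_form[OF pw pw, of "k - 1" l "k - 1"] Q[of "k - 1"] k by (simp add: T_def B_def)
    also have "\<dots> = c \<bullet> ((*\<^sub>v) T ^^ i) c"
      unfolding i symmetric_funpow_scalar_prod[OF T c c, symmetric] by simp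
    finally show ?thesis .
  next
    case False
    define r where "r = i div 2"
    define s where "s = i - r"
    have rs: "i = r + s" "r < k" "s < k" using False i k by (auto simp: r_def s_def)
    show ?thesis
      unfolding rs(1) symmetric_funpow_scalar_prod[OF B g(1) g(1), symmetric]
        symmetric_funpow_scalar_prod[OF T c c, symmetric]
      using Qmat_isometry[OF pw pw, of r s] Q rs by simp
  qed
qed

end

text \<open>These are the block rows of the eigenvector equation, with s = (g . y2)/\<Delta>^2. For
  invertible B = A + l I they make y1 and y2 the multiples of B^-1 g and B^-2 g by the same
  s.\<close>

lemma Mmat_eigenvector_parts:
  assumes A: "A \<in> carrier_mat n n" and g: "g \<in> carrier_vec n"
    and y: "y \<in> carrier_vec (2 * n)" "Mmat n A g \<Delta> *\<^sub>v y = l \<cdot>\<^sub>v y"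
  obtains s where "vec_first y n = (A + l \<cdot>\<^sub>m 1\<^sub>m n) *\<^sub>v vec_last y n"
    "(A + l \<cdot>\<^sub>m 1\<^sub>m n) *\<^sub>v vec_first y n = s \<cdot>\<^sub>v g"
proof -
  define y1 where "y1 = vec_first y n"
  define y2 where "y2 = vec_last y n"
  define s where "s = (g \<bullet> y2) / \<Delta>^2"
  have c: "y1 \<in> carrier_vec n" "y2 \<in> carrier_vec n" by (simp_all add: y1_def y2_def)
  have y_eq: "y = y1 @\<^sub>v y2" using y(1) by (simp add: y1_def y2_def mult_2)
  let ?G = "(1 / \<Delta>^2) \<cdot>\<^sub>m mat n n (\<lambda>(i,j). g $ i * g $ j)"
  have G: "?G *\<^sub>v y2 = s \<cdot>\<^sub>v g"
  proof (rule eq_vecI)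
    fix i assume "i < dim_vec (s \<cdot>\<^sub>v g)"
    then have i: "i < n" using g by simp
    have "(?G *\<^sub>v y2) $ i = (\<Sum>j<n. 1 / \<Delta>^2 * (g $ i * g $ j) * y2 $ j)"
      using i c g by (simp add: scalar_prod_def atLeast0LessThan)
    also have "\<dots> = (1 / \<Delta>^2) * (\<Sum>j<n. g $ j * y2 $ j) * g $ i"
      by (simp add: sum_distrib_left sum_distrib_right mult_ac)
    finally show "(?G *\<^sub>v y2) $ i = (s \<cdot>\<^sub>v g) $ i"
      using i g c by (simp add: s_def scalar_prod_def atLeast0LessThan)
  qed (use g in simp)
  have "Mmat n A g \<Delta> *\<^sub>v y = (- A *\<^sub>v y1 + ?G *\<^sub>v y2) @\<^sub>v (1\<^sub>m n *\<^sub>v y1 + - A *\<^sub>v y2)"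
    unfolding Mmat_def y_eq using A c by (intro four_block_mat_mult_vec) auto
  moreover have "l \<cdot>\<^sub>v y = (l \<cdot>\<^sub>v y1) @\<^sub>v (l \<cdot>\<^sub>v y2)"
    unfolding y_eq using c by (intro eq_vecI) (auto simp: append_vec_def)
  ultimately have "- (A *\<^sub>v y1) + s \<cdot>\<^sub>v g = l \<cdot>\<^sub>v y1 \<and> y1 + - (A *\<^sub>v y2) = l \<cdot>\<^sub>v y2"
    using y(2) A c g G append_vec_eq[of "- (A *\<^sub>v y1) + s \<cdot>\<^sub>v g" n "l \<cdot>\<^sub>v y1"] by simp
  then have i1: "- ((A *\<^sub>v y1) $ i) + s * g $ i = l * y1 $ i"
    and i2: "y1 $ i + - ((A *\<^sub>v y2) $ i) = l * y2 $ i" if "i < n" for i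
    using that A c g
    by (metis carrier_matD(1) carrier_vecD dim_mult_mat_vec index_add_vec(1) index_smult_vec(1)
        index_uminus_vec(1) index_smult_vec(2) index_uminus_vec(2))+
  have "y1 = A *\<^sub>v y2 + l \<cdot>\<^sub>v y2"
  proof (rule eq_vecI)
    fix i assume "i < dim_vec (A *\<^sub>v y2 + l \<cdot>\<^sub>v y2)"
    then have "i < n" using c by simp
    then show "y1 $ i = (A *\<^sub>v y2 + l \<cdot>\<^sub>v y2) $ i" using i2[of i] A c by (simp del: index_mult_mat_vec)
  qed (use A c in simp)
  moreover have "A *\<^sub>v y1 + l \<cdot>\<^sub>v y1 = s \<cdot>\<^sub>v g"
  proof (rule eq_vecI)
    fix i assume "i < dim_vec (s \<cdot>\<^sub>v g)"
    then have "i < n" using g by simp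
    then show "(A *\<^sub>v y1 + l \<cdot>\<^sub>v y1) $ i = (s \<cdot>\<^sub>v g) $ i"
      using i1[of i] A c g by (simp del: index_mult_mat_vec)
  qed (use A c g in simp)
  ultimately show ?thesis
    using that[of s] A c by (simp add: shift_mult_vec y1_def[symmetric] y2_def[symmetric])
qed

section \<open>The bound on the multipliers\<close>

theorem theorem5p9:
  fixes n k :: nat and A :: "real mat" and g :: "real vec" and \<Delta> :: real
    and x_opt :: "real vec" and lam_opt :: real
    and q :: "nat \<Rightarrow> real vec" and h :: "real vec" and lam_k :: real
    and y :: "real vec"
  assumes A_sym: "symmetric_mat n A"
    and g: "g \<in> carrier_vec n" "g \<noteq> 0\<^sub>v n"
    and \<Delta>: "\<Delta> > 0"
    and opt: "trs_global_min n A g \<Delta> x_opt" "trs_multiplier n A g \<Delta> x_opt lam_opt"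
    and easy: "lam_opt > - min_eig A"
    and k: "1 \<le> k" "k \<le> kmax n A g"
    and lanczos: "lanczos_vecs n A g k q"
    and gltr: "trs_global_min k (Tmat n k q A) (vnorm g \<cdot>\<^sub>v unit_vec k 0) \<Delta> h"
              "trs_multiplier k (Tmat n k q A) (vnorm g \<cdot>\<^sub>v unit_vec k 0) \<Delta> h lam_k"
    and bnd: "vnorm x_opt = \<Delta>" "vnorm (Qmat n k q *\<^sub>v h) = \<Delta>"
    and y: "y \<in> carrier_vec (2 * n)" "Mmat n A g \<Delta> *\<^sub>v y = lam_opt \<cdot>\<^sub>v y" "vnorm y = 1"
  shows
   "let A_opt = A + lam_opt \<cdot>\<^sub>m 1\<^sub>m n;
        kappa = (max_eig A + lam_opt) / (min_eig A + lam_opt);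
        y1 = vec_first y n; y2 = vec_last y n;
        T = Tmat n k q A;
        e1 = unit_vec k 0;
        s_k = vnorm (mat_inv A_opt *\<^sub>v x_opt) /
              (vnorm g * (e1 \<bullet> ((mat_inv (T + lam_opt \<cdot>\<^sub>m 1\<^sub>m k) ^\<^sub>m 3) *\<^sub>v e1)))
    in lam_opt - lam_k \<le> 2 * s_k * (1 + 2 * vnorm y1 * real k * sqrt kappa / (vnorm y2 * opnorm A_opt))
                         * ((sqrt kappa - 1) / (sqrt kappa + 1)) ^ (2 * k)"
proof -

  \<comment> \<open>Shifted matrices and their spectral bounds\<close>
  define B where "B = A + lam_opt \<cdot>\<^sub>m 1\<^sub>m n"
  define T where "T = Tmat n k q A + lam_opt \<cdot>\<^sub>m 1\<^sub>m k"
  define e1 where "e1 = (unit_vec k 0 :: real vec)"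
  define c where "c = vnorm g \<cdot>\<^sub>v e1"
  define a where "a = min_eig A + lam_opt"
  define b where "b = max_eig A + lam_opt"
  define \<rho> where "\<rho> = ((sqrt (b / a) - 1) / (sqrt (b / a) + 1)) ^ (2 * k)"
  let ?Q = "Qmat n k q"
  note ctx = A_sym g k(1) lanczos
  note Ac = symmetric_mat_carrier[OF A_sym] and Q = Qmat_carrier[of n k q]
  have n: "n > 0" using g by (cases n) (auto intro!: eq_vecI)
  have B: "symmetric_mat n B" unfolding B_def by (rule symmetric_mat_shift[OF A_sym])
  have T: "symmetric_mat k T" unfolding T_def by (rule symmetric_mat_shift[OF symmetric_Tmat[OF ctx]])
  note Bc = symmetric_mat_carrier[OF B] and Tc = symmetric_mat_carrier[OF T]
  have a: "a > 0" using easy by (simp add: a_def)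
  have form: "a * (v \<bullet> v) \<le> v \<bullet> (B *\<^sub>v v)" "v \<bullet> (B *\<^sub>v v) \<le> b * (v \<bullet> v)" if "v \<in> carrier_vec n" for v
    using quadratic_form_eig_bounds[OF A_sym n that] that Ac
    by (simp_all add: B_def a_def b_def shift_mult_vec scalar_prod_add_distrib[of _ n] distrib_right)
  have T_form: "u \<bullet> (T *\<^sub>v v) = (?Q *\<^sub>v u) \<bullet> (B *\<^sub>v (?Q *\<^sub>v v))"
    if "u \<in> carrier_vec k" "v \<in> carrier_vec k" for u v
    unfolding T_def B_def by (rule Tmat_shift_form[OF ctx that])
  \<comment> \<open>Q is an isometry, so the compression inherits both bounds of B.\<close>
  have formT: "a * (v \<bullet> v) \<le> v \<bullet> (T *\<^sub>v v)" "v \<bullet> (T *\<^sub>v v) \<le> b * (v \<bullet> v)" if "v \<in> carrier_vec k" for v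
    using form[of "?Q *\<^sub>v v"] T_form[OF that that] Qmat_isometry[OF ctx that that] Q that by simp_all
  have invB: "mat_inv B \<in> carrier_mat n n" "v \<in> carrier_vec n \<Longrightarrow> B *\<^sub>v (mat_inv B *\<^sub>v v) = v"
    "v \<in> carrier_vec n \<Longrightarrow> mat_inv B *\<^sub>v (B *\<^sub>v v) = v" for v
    using mat_inv_pd[OF Bc a form(1)] by auto
  have invT: "mat_inv T \<in> carrier_mat k k" "v \<in> carrier_vec k \<Longrightarrow> T *\<^sub>v (mat_inv T *\<^sub>v v) = v"
    "v \<in> carrier_vec k \<Longrightarrow> mat_inv T *\<^sub>v (T *\<^sub>v v) = v" for v
    using mat_inv_pd[OF Tc a formT(1)] by auto
  have G: "vnorm g > 0" by (rule vnorm_pos[OF g])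
  have gg: "g \<bullet> g > 0" using G by (simp add: vnorm_def)
  have "a * (g \<bullet> g) \<le> b * (g \<bullet> g)" using form[OF g(1)] by linarith
  then have ab: "a \<le> b" using gg by simp
  have e1: "e1 \<in> carrier_vec k" and c: "c \<in> carrier_vec k" by (simp_all add: e1_def c_def)
  \<comment> \<open>x = B^-1 g turns out to be \<open>- x_opt\<close>, and w = B^-2 g; the primed
    vectors are their projected counterparts.\<close>
  define x where "x = mat_inv B *\<^sub>v g"
  define w where "w = mat_inv B *\<^sub>v x"
  define x' where "x' = mat_inv T *\<^sub>v c"
  define w' where "w' = mat_inv T *\<^sub>v x'"
  have x: "x \<in> carrier_vec n" "B *\<^sub>v x = g" and w: "w \<in> carrier_vec n" "B *\<^sub>v w = x"
    using invB g by (auto simp: x_def w_def)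
  have x': "x' \<in> carrier_vec k" "T *\<^sub>v x' = c" and w': "w' \<in> carrier_vec k" "T *\<^sub>v w' = x'"
    using invT c by (auto simp: x'_def w'_def)
  have Qc: "?Q *\<^sub>v c = g" unfolding c_def e1_def by (rule Qmat_first[OF ctx])

  \<comment> \<open>Moments of the full and the projected problem\<close>
  define m where "m = (\<lambda>i. w \<bullet> ((*\<^sub>v) B ^^ i) w)"
  define m' where "m' = (\<lambda>i. w' \<bullet> ((*\<^sub>v) T ^^ i) w')"
  have m: "moments_on a b m" unfolding m_def by (rule moments_on_quadratic_form[OF B w(1) form])
  have m': "moments_on a b m'" unfolding m'_def by (rule moments_on_quadratic_form[OF T w'(1) formT])
  have m_split: "m (i + j) = ((*\<^sub>v) B ^^ i) w \<bullet> ((*\<^sub>v) B ^^ j) w" for i j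
    unfolding m_def by (rule symmetric_funpow_scalar_prod[OF B w(1) w(1), symmetric])
  have m'_split: "m' (i + j) = ((*\<^sub>v) T ^^ i) w' \<bullet> ((*\<^sub>v) T ^^ j) w'" for i j
    unfolding m'_def by (rule symmetric_funpow_scalar_prod[OF T w'(1) w'(1), symmetric])
  have B2: "((*\<^sub>v) B ^^ 2) w = g" and T2: "((*\<^sub>v) T ^^ 2) w' = c"
    using x w x' w' by (simp_all add: numeral_2_eq_2)
  have m2: "m 2 = x \<bullet> x" "m 2 = w \<bullet> g" using m_split[of 1 1] m_split[of 0 2] w B2 by (simp_all add: numeral_2_eq_2)
  have m3: "m 3 = x \<bullet> g" using m_split[of 1 2] w B2 by (simp add: numeral_3_eq_3)
  have m'1: "m' 1 = w' \<bullet> x'" using w' by (simp add: m'_def)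
  have m'2: "m' 2 = x' \<bullet> x'" using m'_split[of 1 1] w' by (simp add: numeral_2_eq_2)
  have m'3: "m' 3 = x' \<bullet> c" using m'_split[of 1 2] w' T2 by (simp add: numeral_3_eq_3)
  have m_eq: "m i = m' i" if i: "4 \<le> i" "i \<le> 2 * k + 3" for i
  proof -
    define j where "j = i - 4"
    have j: "i = 2 + (j + 2)" "j \<le> 2 * k - 1" using i by (simp_all add: j_def)
    have "m i = g \<bullet> ((*\<^sub>v) B ^^ j) g" unfolding j(1) m_split funpow_add by (simp add: B2)
    also have "\<dots> = c \<bullet> ((*\<^sub>v) T ^^ j) c"
      unfolding B_def T_def c_def e1_def by (rule gauss_quadrature_exact[OF ctx j(2)])
    also have "\<dots> = m' i" unfolding j(1) m'_split funpow_add by (simp add: T2)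
    finally show ?thesis .
  qed
  \<comment> \<open>Galerkin argument: z = Q x' satisfies z . B z = z . g, so 0 \<le> (z - x) . B (z
    - x) = x . g - z . g.\<close>
  have m3_le: "m' 3 \<le> m 3"
  proof -
    let ?z = "?Q *\<^sub>v x'"
    have z: "?z \<in> carrier_vec n" using Q x' by simp
    have "x' \<bullet> c = ?z \<bullet> g" using Qmat_isometry[OF ctx x'(1) c] Qc by simp
    moreover have "x' \<bullet> c = ?z \<bullet> (B *\<^sub>v ?z)" using T_form[OF x'(1) x'(1)] x' by simp
    moreover have "(?z + (- 1) \<cdot>\<^sub>v x) \<bullet> (B *\<^sub>v (?z + (- 1) \<cdot>\<^sub>v x)) \<ge> 0"
      using form(1)[of "?z + (- 1) \<cdot>\<^sub>v x"] z x a scalar_prod_self_nonneg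
      by (meson add_carrier_vec less_imp_le mult_nonneg_nonneg order_trans smult_carrier_vec)
    ultimately show ?thesis
      unfolding m3 m'3 using quadratic_form_add_smult[OF B z x(1), of "- 1"] x by simp
  qed

  define E where "E = m 2 + 2 * real k * sqrt (b / a) / b * m 3"
  have err: "m 2 - m' 2 \<le> 4 * \<rho> * E"
  proof (cases "a < b")
    case True
    show ?thesis unfolding \<rho>_def E_def
      by (rule quadrature_error[OF m m' a True]) (use m_eq m3_le in auto)
  next
    \<comment> \<open>Here \<kappa> = 1: the error vanishes, and so does \<rho> because its exponent
      2k is positive.\<close>
    case False
    then have ba: "b = a" using ab by simp
    have "m 4 = m' 4" using m_eq[of 4] k by simp
    then have "m 2 = m' 2" using quadrature_error_degenerate m m' a unfolding ba by blast
    moreover have "\<rho> = 0" using a k by (simp add: \<rho>_def ba)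
    ultimately show ?thesis by simp
  qed

  \<comment> \<open>Convexity and the gap between the multipliers\<close>
  have x_opt: "x_opt \<in> carrier_vec n" using opt by (simp add: trs_global_min_def)
  have "B *\<^sub>v (- x_opt) = g"
    using opt(2) mult_mat_vec_uminus[OF Bc x_opt] by (simp add: trs_multiplier_def B_def)
  then have x_eq: "- x_opt = x" unfolding x_def using invB(3)[of "- x_opt"] x_opt by simp
  then have xo: "x_opt = - x" by (metis uminus_uminus_vec)
  have xx: "x \<bullet> x = \<Delta> * \<Delta>"
    using bnd(1) vnorm_sq[of x_opt] x unfolding xo by simp

  have h: "h \<in> carrier_vec k" using gltr by (simp add: trs_global_min_def)
  have hh: "h \<bullet> h = \<Delta> * \<Delta>"
    using bnd(2) vnorm_sq[of "?Q *\<^sub>v h"] Qmat_isometry[OF ctx h h] by simp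
  \<comment> \<open>With this shift T becomes T_k + lam_k I, and \<open>- h\<close> solves the
    shifted system with right-hand side c.\<close>
  define \<mu> where "\<mu> = lam_k - lam_opt"
  have T_shift: "T + \<mu> \<cdot>\<^sub>m 1\<^sub>m k = Tmat n k q A + lam_k \<cdot>\<^sub>m 1\<^sub>m k"
    unfolding T_def \<mu>_def using Tmat_carrier[OF ctx] by (intro eq_matI) auto
  have Sc: "T + \<mu> \<cdot>\<^sub>m 1\<^sub>m k \<in> carrier_mat k k" using Tc by simp
  have "(T + \<mu> \<cdot>\<^sub>m 1\<^sub>m k) *\<^sub>v (- h) = T *\<^sub>v (T *\<^sub>v w')"
    using gltr(2) mult_mat_vec_uminus[OF Sc h] x' w'
    by (simp add: trs_multiplier_def T_shift c_def e1_def)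
  moreover have "psd_mat k (T + \<mu> \<cdot>\<^sub>m 1\<^sub>m k)"
    using gltr(2) by (simp add: trs_multiplier_def T_shift)
  ultimately have "x' \<bullet> x' - 2 * \<mu> * (w' \<bullet> x') \<le> - h \<bullet> - h"
    using shifted_solution_norm_convex[OF T a formT(1) w'(1), of "- h" \<mu>] h w' by simp
  \<comment> \<open>Both solutions lie on the sphere, so h . h = \<Delta>^2 = \<open>m 2\<close>,
    which turns the tangent inequality into a bound by the quadrature error.\<close>
  then have conv: "2 * (lam_opt - lam_k) * m' 1 \<le> m 2 - m' 2"
    unfolding m'1 m'2 m2(1) xx \<mu>_def using h hh by (simp add: algebra_simps)

  \<comment> \<open>The denominator of s_k\<close>
  define S where "S = mat_inv T"
  define \<tau> where "\<tau> = e1 \<bullet> ((S ^\<^sub>m 3) *\<^sub>v e1)"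
  have m'1_\<tau>: "m' 1 = vnorm g * vnorm g * \<tau>"
  proof -
    have Sc: "S \<in> carrier_mat k k" using invT by (simp add: S_def)
    have "(S ^\<^sub>m 3) *\<^sub>v c = S *\<^sub>v w'"
      using pow_mat_mult_vec[OF Sc c, of 3] by (simp add: numeral_3_eq_3 S_def w'_def x'_def)
    then have "c \<bullet> ((S ^\<^sub>m 3) *\<^sub>v c) = (T *\<^sub>v x') \<bullet> (S *\<^sub>v w')" using x' by simp
    also have "\<dots> = x' \<bullet> (T *\<^sub>v (S *\<^sub>v w'))"
      using symmetric_mat_scalar_prod[OF T x'(1), of "S *\<^sub>v w'"] Sc w' by simp
    also have "\<dots> = m' 1" unfolding m'1 using invT(2)[OF w'(1)] comm_scalar_prod[OF x'(1) w'(1)] by (simp add: S_def)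
    finally have "m' 1 = c \<bullet> ((S ^\<^sub>m 3) *\<^sub>v c)" ..
    also have "\<dots> = vnorm g * vnorm g * \<tau>"
      using Sc e1 pow_carrier_mat[OF Sc, of 3]
      by (simp add: c_def \<tau>_def mult_mat_vec[of _ k k])
    finally show ?thesis .
  qed
  have m'1_pos: "m' 1 > 0"
  proof -
    have "w' \<bullet> w' \<noteq> 0"
    proof
      assume "w' \<bullet> w' = 0"
      then have "w' = 0\<^sub>v k" using scalar_prod_self_eq_0 w' by blast
      then have "x' = 0\<^sub>v k" using w' Tc by auto
      then have "c = 0\<^sub>v k" using x' Tc by auto
      then have "g = 0\<^sub>v n" using Qc Q by auto
      then show False using g by simp
    qed
    then have "w' \<bullet> w' > 0" using scalar_prod_self_nonneg[of w'] by linarith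
    then have "0 < a * (w' \<bullet> w')" using a by simp
    then show ?thesis unfolding m'1 using formT(1)[OF w'(1)] w' by simp
  qed
  then have \<tau>: "\<tau> > 0" using G unfolding m'1_\<tau> by (simp add: zero_less_mult_iff)

  \<comment> \<open>The two halves of the eigenvector of M\<close>
  define y1 where "y1 = vec_first y n"
  define y2 where "y2 = vec_last y n"
  have yc: "y1 \<in> carrier_vec n" "y2 \<in> carrier_vec n" by (simp_all add: y1_def y2_def)
  obtain s where s: "y1 = B *\<^sub>v y2" "B *\<^sub>v y1 = s \<cdot>\<^sub>v g"
    using Mmat_eigenvector_parts[OF Ac g(1) y(1,2)] by (auto simp: y1_def y2_def B_def)
  have y1: "y1 = s \<cdot>\<^sub>v x"
    using invB(3)[OF yc(1)] invB(1) g by (simp add: s(2) x_def mult_mat_vec[of _ n n])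
  have y2: "y2 = s \<cdot>\<^sub>v w"
    using invB(3)[OF yc(2)] invB(1) x by (simp add: s(1)[symmetric] y1 w_def mult_mat_vec[of _ n n])
  have "y = y1 @\<^sub>v y2" using y(1) by (simp add: y1_def y2_def mult_2)
  \<comment> \<open>Unit length excludes s = 0.\<close>
  then have "y1 \<bullet> y1 + y2 \<bullet> y2 = 1"
    using y(3) vnorm_sq[of y] scalar_prod_append[OF yc yc] by simp
  then have "s \<noteq> 0" using x w by (auto simp: y1 y2)
  have "w \<noteq> 0\<^sub>v n"
  proof
    assume "w = 0\<^sub>v n"
    then have "x = 0\<^sub>v n" using w Bc by auto
    then show False using x Bc g by auto
  qed
  then have wpos: "vnorm w > 0" using w by (intro vnorm_pos) auto
  \<comment> \<open>The common factor s cancels, so |y1|/|y2| = |x|/|w|.\<close>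
  have ratio: "vnorm w * (vnorm y1 / vnorm y2) = vnorm x"
    using \<open>s \<noteq> 0\<close> wpos by (simp add: y1 y2 vnorm_smult)

  \<comment> \<open>Assembling the bound\<close>
  have opn: "0 < opnorm B" "opnorm B \<le> b"
    using opnorm_pd_bounds[OF B n a form] by auto
  have kappa: "b / a \<ge> 1" using ab a by simp
  then have \<rho>_nonneg: "\<rho> \<ge> 0" by (simp add: \<rho>_def)
  \<comment> \<open>Writing \<open>m 2\<close> as w . g instead of x . x makes Cauchy-Schwarz
    produce |w| = |A_opt^-1 x_opt| and a common factor |g|.\<close>
  have E_le: "E \<le> vnorm g * (vnorm w + 2 * real k * sqrt (b / a) / opnorm B * vnorm x)"
  proof -
    have "m 2 \<le> vnorm g * vnorm w"
      using scalar_prod_le_vnorm[OF w(1) g(1)] by (simp add: m2(2) mult.commute)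
    moreover have "2 * real k * sqrt (b / a) / b * m 3
        \<le> 2 * real k * sqrt (b / a) / opnorm B * (vnorm g * vnorm x)"
    proof (rule mult_mono)
      show "2 * real k * sqrt (b / a) / b \<le> 2 * real k * sqrt (b / a) / opnorm B"
        using opn kappa a ab by (intro divide_left_mono) auto
      show "m 3 \<le> vnorm g * vnorm x"
        using scalar_prod_le_vnorm[OF x(1) g(1)] by (simp add: m3 mult.commute)
      show "0 \<le> m 3"
        using form(1)[OF x(1)] x a scalar_prod_self_nonneg[of x] unfolding m3
        by (smt (verit) mult_nonneg_nonneg)
    qed (use opn kappa in auto)
    ultimately show ?thesis unfolding E_def by (simp add: algebra_simps)
  qed
  have "2 * (lam_opt - lam_k) * (vnorm g * vnorm g * \<tau>)
      \<le> 4 * \<rho> * (vnorm g * (vnorm w + 2 * real k * sqrt (b / a) / opnorm B * vnorm x))"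
    using conv err mult_left_mono[OF E_le, of "4 * \<rho>"] \<rho>_nonneg unfolding m'1_\<tau> by linarith
  \<comment> \<open>One of the two factors |g| from \<open>m' 1\<close> cancels against the one
    extracted from E; the other stays in s_k.\<close>
  then have "(lam_opt - lam_k) * (vnorm g * \<tau>) * (2 * vnorm g)
      \<le> 2 * \<rho> * (vnorm w + 2 * real k * sqrt (b / a) / opnorm B * vnorm x) * (2 * vnorm g)"
    by (simp only: mult_ac)
  then have "(lam_opt - lam_k) * (vnorm g * \<tau>)
      \<le> 2 * \<rho> * (vnorm w + 2 * real k * sqrt (b / a) / opnorm B * vnorm x)"
    using G by (simp only: mult_le_cancel_right_pos mult_pos_pos zero_less_numeral)
  then have "lam_opt - lam_k
      \<le> 2 * \<rho> * (vnorm w + 2 * real k * sqrt (b / a) / opnorm B * vnorm x) / (vnorm g * \<tau>)"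
    using G \<tau> by (simp add: pos_le_divide_eq)
  also have "vnorm w + 2 * real k * sqrt (b / a) / opnorm B * vnorm x
      = vnorm w * (1 + 2 * vnorm y1 * real k * sqrt (b / a) / (vnorm y2 * opnorm B))"
    unfolding ratio[symmetric] by (simp add: algebra_simps)
  finally have "lam_opt - lam_k \<le> 2 * (vnorm w / (vnorm g * \<tau>))
      * (1 + 2 * vnorm y1 * real k * sqrt (b / a) / (vnorm y2 * opnorm B)) * \<rho>"
    by (simp add: mult_ac)
  moreover have "vnorm (mat_inv B *\<^sub>v x_opt) = vnorm w"
    unfolding xo using mult_mat_vec_uminus[OF invB(1) x(1)] w by (simp add: w_def[symmetric] vnorm_def)
  ultimately show ?thesis
    unfolding Let_def B_def[symmetric] T_def[symmetric] y1_def[symmetric] y2_def[symmetric]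
      e1_def[symmetric] a_def[symmetric] b_def[symmetric] S_def[symmetric] \<tau>_def[symmetric]
      \<rho>_def[symmetric] by simp
qed

end
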